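(* Let $X$ be a separable commutative $F$-algebra that supports a dense freely generated subalgebra, and let $T$ be an operator on $X$. Suppose there exist a function $E:\mathbb{C}\to X$ and an entire function $\phi:\mathbb{C}\to\mathbb{C}$ with $|\phi(0)|=1$ satisfying the following: (a) for each $\lambda\in\mathbb{C}$, $TE(\lambda)=\phi(\lambda)E(\lambda)$; (b) for each $\lambda,\mu\in\mathbb{C}$, $E(\lambda)E(\mu)=E(\lambda+\mu)$; (c) for each subset $\Lambda$ of $\mathbb{C}$ having an accumulation point in $\mathbb{C}$, the set $\{E(\lambda):\lambda\in\Lambda\}$ has dense linear span in $X$; and (d) the integer $\min\{n\in\mathbb{N}:\phi^{(n)}(0)\neq0\}$ is odd, and there exist an angle $\theta\in[0,2\pi)$ and positive scalars $r,R$ such that, with $h_\phi(\theta):=\limsup_{t\to\infty}\log|\phi(te^{i\theta})|^{1/t}$ the Phragmén–Lindelöf indicator function of $\phi$, $$|\phi(te^{i\theta})|<1\ \text{ for } 0<t<r,\qquad\text{and}\qquad |\phi(Re^{i\theta})|>\max\{1,e^{h_\phi(\theta)R}\}.$$ Then the generic element $f=(f_n)_{n=1}^\infty$ of $X^{\mathbb{N}}$ freely generates a dense subalgebra of $X$ consisting entirely (but zero) of hypercyclic vectors for $T$.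
   Context: $\mathbb{N}$ is the set of positive integers. An $F$-algebra is a (complex) topological algebra whose underlying topological vector space is an $F$-space (completely metrizable by a translation-invariant metric). An operator on $X$ is a continuous linear map $X\to X$ (not assumed multiplicative). A vector $x$ is hypercyclic for $T$ if $\{T^nx:n\ge0\}$ is dense in $X$. A set of elements of a commutative algebra is a set of free generators (and the subalgebra it generates is freely generated) if $P(g_1,\dots,g_k)\neq0$ for any distinct elements $g_1,\dots,g_k$ of the set and every nonzero polynomial $P$ in $k$ commuting variables without constant term; the subalgebra generated by the set consists of all such $P(g_1,\dots,g_k)$ together with $0$. $X^{\mathbb{N}}$ carries the product topology. A statement holds for the generic element of an $F$-space $Y$ if it holds at each element of some dense $G_\delta$ subset of $Y$. *)

theory Defs
  imports "HOL-Analysis.Analysis" "HOL-Library.Poly_Mapping"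
begin

section \<open>Commutative \<open>F\<close>-algebras\<close>

text \<open>
  The algebra is the whole type \<^typ>\<open>'a\<close>; it need not have a unit. The sort provides a jointly
  continuous addition and multiplication and a complete metric inducing the topology; the locale
  adds complex scalars and translation invariance. Fixing one complete invariant metric loses no
  generality: apart from \<open>translation_invariant\<close>, every notion used below is purely topological.
\<close>

locale comm_F_algebra = vector_space smul
  for smul :: "complex \<Rightarrow> 'a \<Rightarrow>
    'a::{comm_ring, topological_ab_group_add, topological_semigroup_mult, complete_space}" +
  assumes smul_mult_left: "smul c x * y = smul c (x * y)"
    and continuous_smul: "continuous_on UNIV (\<lambda>(c, x). smul c x)"
    and translation_invariant: "dist (x + z) (y + z) = dist x y"

definition hypercyclic :: "('a::topological_space \<Rightarrow> 'a) \<Rightarrow> 'a \<Rightarrow> bool" where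
  "hypercyclic T x \<longleftrightarrow> closure (range (\<lambda>n. (T ^^ n) x)) = UNIV"

definition generically :: "('b::topological_space \<Rightarrow> bool) \<Rightarrow> bool" where
  "generically Q \<longleftrightarrow> (\<exists>A. gdelta A \<and> closure A = UNIV \<and> (\<forall>x\<in>A. Q x))"


section \<open>Polynomials without constant term, evaluated in a possibly non-unital algebra\<close>

text \<open>
  A polynomial is a finitely supported map from exponents to coefficients, and an exponent is a
  finitely supported map from variable indices to powers. The exponent \<open>0\<close> is the constant monomial.
\<close>

definition polys_without_constant :: "nat \<Rightarrow> ((nat \<Rightarrow>\<^sub>0 nat) \<Rightarrow>\<^sub>0 complex) set" where
  "polys_without_constant k =
     {P. Poly_Mapping.lookup P 0 = 0 \<and>
         (\<forall>\<alpha>\<in>Poly_Mapping.keys P. Poly_Mapping.keys \<alpha> \<subseteq> {..<k})}"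

text \<open>
  Product of a nonempty list, avoiding a unit. The value at \<open>[]\<close> is a dummy: it corresponds to the
  constant monomial, which never occurs in a polynomial without constant term.
\<close>

fun nonempty_prod :: "'a::comm_ring list \<Rightarrow> 'a" where
  "nonempty_prod [] = 0"
| "nonempty_prod [x] = x"
| "nonempty_prod (x # y # xs) = x * nonempty_prod (y # xs)"

definition eval_monomial :: "(nat \<Rightarrow> 'a::comm_ring) \<Rightarrow> (nat \<Rightarrow>\<^sub>0 nat) \<Rightarrow> 'a" where
  "eval_monomial g \<alpha> =
     nonempty_prod (concat (map (\<lambda>i. replicate (Poly_Mapping.lookup \<alpha> i) (g i))
       (sorted_list_of_set (Poly_Mapping.keys \<alpha>))))"

definition eval_poly ::
  "(complex \<Rightarrow> 'a \<Rightarrow> 'a) \<Rightarrow> ((nat \<Rightarrow>\<^sub>0 nat) \<Rightarrow>\<^sub>0 complex) \<Rightarrow> (nat \<Rightarrow> 'a::comm_ring) \<Rightarrow> 'a" where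
  "eval_poly smul P g =
     (\<Sum>\<alpha>\<in>Poly_Mapping.keys P. smul (Poly_Mapping.lookup P \<alpha>) (eval_monomial g \<alpha>))"

definition free_generators :: "(complex \<Rightarrow> 'a \<Rightarrow> 'a) \<Rightarrow> 'a::comm_ring set \<Rightarrow> bool" where
  "free_generators smul G \<longleftrightarrow>
     (\<forall>k g P. inj_on g {..<k} \<and> g ` {..<k} \<subseteq> G \<and> P \<in> polys_without_constant k \<and> P \<noteq> 0
        \<longrightarrow> eval_poly smul P g \<noteq> 0)"

definition generated_subalgebra :: "(complex \<Rightarrow> 'a \<Rightarrow> 'a) \<Rightarrow> 'a::comm_ring set \<Rightarrow> 'a set" where
  "generated_subalgebra smul G =
     insert 0 {eval_poly smul P g | k g P.
       inj_on g {..<k} \<and> g ` {..<k} \<subseteq> G \<and> P \<in> polys_without_constant k \<and> P \<noteq> 0}"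


section \<open>The Phragmen--Lindeloef indicator\<close>

text \<open>
  The indicator may be infinite, and \<open>\<phi>\<close> may vanish on the ray, so logarithm and exponential take
  extended real values (in particular \<open>log 0 = -\<infinity>\<close>, unlike \<open>ln 0 = 0\<close> on the reals).
\<close>

definition log_ereal :: "real \<Rightarrow> ereal" where
  "log_ereal x = (if x = 0 then -\<infinity> else ereal (ln x))"

definition exp_ereal :: "ereal \<Rightarrow> ereal" where
  "exp_ereal x =
     (if x = \<infinity> then \<infinity> else if x = -\<infinity> then 0 else ereal (exp (real_of_ereal x)))"

definition indicator_function :: "(complex \<Rightarrow> complex) \<Rightarrow> real \<Rightarrow> ereal" where
  "indicator_function \<phi> \<theta> =
     Limsup at_top (\<lambda>t::real. log_ereal (cmod (\<phi> (of_real t * cis \<theta>)) powr (1 / t)))"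

end

theory Submission
  imports Defs "HOL-Complex_Analysis.Complex_Analysis"
begin

text \<open>
  A value of a polynomial at a sequence \<open>f\<close> is a combination of finitely many monomials
  in the coordinates of \<open>f\<close>. If one can choose a leading monomial among them so that, along some iterates of \<open>T\<close>,
  the leading monomial approaches any prescribed vector while the others approach \<open>0\<close>, then the value is
  hypercyclic whatever its (nonzero) leading coefficient is. For a fixed finite set of monomials, a fixed target and
  a fixed tolerance this is an open condition on \<open>f\<close>; as targets range over a countable dense set, Baire's theorem
  leaves the task of proving that each such condition holds on a dense set (\<open>monomials_reach_target\<close>).

  For this, let \<open>m\<close> be the degree of the leading monomial. The \<open>i\<close>-th coordinate is perturbed to
  \<open>u\<^sub>i + (\<Sum>v. d\<^sub>v (\<kappa>\<^sub>i / \<omega>\<^sub>v)\<^sup>n E (v / m))\<close>, where \<open>u\<^sub>i\<close> is a combination of eigenvectors \<open>E l\<close> with \<open>l\<close> close to \<open>0\<close> on the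
  ray where \<open>\<bar>\<phi>\<bar> < 1\<close>, where \<open>\<omega>\<^sub>v ^ m = \<phi> v\<close>, and where \<open>(\<Sum>v. d\<^sub>v ^ m E v)\<close> is close to the target. Because the
  \<open>E l\<close> multiply like exponentials, every monomial expands into a sum of eigenvectors, and applying the \<open>n\<close>-th
  iterate of \<open>T\<close> multiplies each of them by an \<open>n\<close>-th power. The ratio of such a power must be \<open>1\<close> for the \<open>m\<close>-th
  powers of single summands in the leading monomial, and smaller than \<open>1\<close> in modulus for everything else
  (\<open>monomial_orbit_limit\<close>). There are three kinds of other terms.

  \<^item> Without a growing summand the parameters add up to a point of the ray near \<open>0\<close>, where \<open>\<bar>\<phi>\<bar> < 1\<close>.
  \<^item> With \<open>0 < j < m\<close> growing summands the ratio is close to \<open>\<phi> (j z / m) / \<phi> z powr (j / m)\<close> in modulus, where the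
    parameters \<open>v\<close> are near \<open>z\<close>. The point \<open>z\<close> is the first one on the ray up to \<open>R\<close> at which \<open>\<bar>\<phi> (t e)\<bar> powr (1 / t)\<close>, with
    \<open>e\<close> the direction of the ray, is maximal; this makes the modulus smaller than \<open>1\<close>
    (\<open>least_maximiser_of_root_growth\<close>). It also gives \<open>\<bar>\<phi> z\<bar> > 1\<close>, so that the perturbations tend to \<open>0\<close>.
  \<^item> With \<open>m\<close> growing summands that are not all equal, the modulus is smaller than \<open>1\<close> because the \<open>v\<close> are taken from
    a segment on which \<open>log \<bar>\<phi>\<bar>\<close> is strictly convex (\<open>strict_jensen_of_tangents\<close>). Such a segment exists arbitrarily
    close to \<open>z\<close>, since otherwise \<open>\<phi>\<close> would be the exponential of an affine map
    (\<open>exponential_if_log_affine\<close>); as \<open>\<bar>\<phi> 0\<bar> = 1\<close>, it could not be below \<open>1\<close> at one point of the ray and above \<open>1\<close> at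
    another.

  Terms with \<open>m\<close> equal growing summands in a competing monomial of the same degree \<open>m\<close> are suppressed by the weights
  \<open>\<kappa>\<^sub>i\<close>. The leading monomial is the one of maximal degree whose exponent vector has maximal Euclidean length, and
  the weights come from the inner product with that vector (\<open>exists_dominating_list\<close>, \<open>separating_weights\<close>).
\<close>

section \<open>Growth of an entire function along a ray\<close>

text \<open>
  The value \<open>t0\<close> is the first maximiser of \<open>g t powr (1 / t)\<close> on \<open>[r, R]\<close>. Being the first one, it beats every smaller
  \<open>t\<close> strictly, and after raising to the power \<open>s * t0\<close> this says that \<open>g\<close> at the fraction \<open>s\<close> of \<open>t0\<close> is
  strictly below the value that pure exponential growth up to \<open>t0\<close> would give. This is the strict inequality
  that makes products with too few growing factors negligible.
\<close>

lemma least_maximiser_of_root_growth: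
  fixes g :: "real \<Rightarrow> real"
  assumes cont: "continuous_on UNIV g" and nonneg: "\<And>t. g t \<ge> 0"
    and pos: "0 < r" "0 < R"
    and small: "\<And>t. 0 < t \<Longrightarrow> t < r \<Longrightarrow> g t < 1" and large: "1 < g R"
  obtains t0 where "0 < t0" "1 < g t0" "\<And>s. 0 < s \<Longrightarrow> s < 1 \<Longrightarrow> g (s * t0) < g t0 powr s"
proof -
  define G where "G t = g t powr (1 / t)" for t
  have "r \<le> R" using small[of R] large pos by force
  have contG: "continuous_on {r..R} G"
    unfolding G_def using pos nonneg
    by (intro continuous_on_powr' continuous_intros continuous_on_subset[OF cont]) auto
  obtain tm where tm: "tm \<in> {r..R}" "\<And>t. t \<in> {r..R} \<Longrightarrow> G t \<le> G tm"
    using continuous_attains_sup[OF compact_Icc _ contG] \<open>r \<le> R\<close> by fastforce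
  define S where "S = {r..R} \<inter> G -` {G tm}"
  have "closed S"
    unfolding S_def by (intro continuous_closed_preimage contG closed_singleton closed_atLeastAtMost)
  then have "compact S"
    using compact_Int_closed[OF compact_Icc[of r R]] by (metis S_def Int_assoc Int_absorb)
  moreover have "S \<noteq> {}" using tm by (auto simp: S_def)
  ultimately obtain t0 where t0: "t0 \<in> S" "\<And>t. t \<in> S \<Longrightarrow> t0 \<le> t"
    using compact_attains_inf by metis
  have G1: "1 < G R" unfolding G_def using large pos by (simp add: gr_one_powr)
  have max: "G t \<le> G t0" if "t \<in> {r..R}" for t using tm(2)[OF that] t0(1) by (simp add: S_def)
  have "0 < t0" "r \<le> t0" "t0 \<le> R" using t0(1) pos by (auto simp: S_def)
  have G0: "1 < G t0" using G1 max[of R] \<open>r \<le> R\<close> by force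
  have smaller: "G t < G t0" if "0 < t" "t < t0" for t
  proof (cases "t < r")
    case True
    have "G t \<le> 1" using small[OF \<open>0 < t\<close> True] nonneg[of t] that by (auto simp: G_def intro!: powr_le1)
    then show ?thesis using G0 by simp
  next
    case False
    then have "t \<in> {r..R}" using that \<open>t0 \<le> R\<close> by auto
    then have "G t \<noteq> G t0" using t0 that by (force simp: S_def)
    then show ?thesis using max[OF \<open>t \<in> {r..R}\<close>] by simp
  qed
  have root: "g t = G t powr t" if "0 < t" for t
    using that nonneg[of t] by (simp add: G_def powr_powr)
  show ?thesis
  proof (rule that[OF \<open>0 < t0\<close>])
    show "1 < g t0" using G0 \<open>0 < t0\<close> by (simp add: root gr_one_powr)
    fix s :: real assume s: "0 < s" "s < 1"
    have "g (s * t0) = G (s * t0) powr (s * t0)" using s \<open>0 < t0\<close> by (intro root) auto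
    also have "\<dots> < G t0 powr (s * t0)"
      using s \<open>0 < t0\<close> by (intro powr_less_mono2 smaller) (auto simp: G_def)
    also have "\<dots> = g t0 powr s" using \<open>0 < t0\<close> by (simp add: root powr_powr mult.commute)
    finally show "g (s * t0) < g t0 powr s" .
  qed
qed

lemma mean_in_interval:
  fixes ts :: "real list"
  assumes "ts \<noteq> []" "set ts \<subseteq> {p..q}"
  shows "sum_list ts / length ts \<in> {p..q}"
proof -
  have "sum_list (map (\<lambda>t. p) ts) \<le> sum_list (map (\<lambda>t. t) ts)"
    "sum_list (map (\<lambda>t. t) ts) \<le> sum_list (map (\<lambda>t. q) ts)"
    using assms(2) by (intro sum_list_mono; auto)+
  then show ?thesis using assms(1) by (simp add: sum_list_triv field_simps)
qed

text \<open>
  Adding up the tangent inequalities at the mean cancels the linear terms; a single point different from the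
  mean makes the sum strict.
\<close>

lemma strict_jensen_of_tangents:
  fixes g D :: "real \<Rightarrow> real"
  assumes tangent: "\<And>t c. t \<in> {p..q} \<Longrightarrow> c \<in> {p..q} \<Longrightarrow> t \<noteq> c \<Longrightarrow> g c + D c * (t - c) < g t"
    and ts: "ts \<noteq> []" "set ts \<subseteq> {p..q}"
  shows "length ts * g (sum_list ts / length ts) \<le> sum_list (map g ts)" (is ?weak)
    and "\<nexists>t. set ts \<subseteq> {t} \<Longrightarrow> length ts * g (sum_list ts / length ts) < sum_list (map g ts)"
proof -
  define n where "n = length ts"
  define c where "c = sum_list ts / n"
  have n: "n > 0" using ts by (simp add: n_def)
  have c: "c \<in> {p..q}" unfolding c_def n_def by (rule mean_in_interval[OF ts])
  have "sum_list (map (\<lambda>t. g c + D c * (t - c)) ts) = n * g c + D c * (sum_list ts - n * c)"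
    unfolding n_def by (induction ts) (simp_all add: algebra_simps)
  also have "\<dots> = n * g c" using n by (simp add: c_def)
  finally have eq: "n * g c = sum_list (map (\<lambda>t. g c + D c * (t - c)) ts)" by simp
  have le: "g c + D c * (t - c) \<le> g t" if "t \<in> set ts" for t
    using tangent[of t c] that ts(2) c by (cases "t = c") force+
  show ?weak
    using eq sum_list_mono[of ts "\<lambda>t. g c + D c * (t - c)" g, OF le] by (simp add: n_def c_def)
  assume "\<nexists>t. set ts \<subseteq> {t}"
  then obtain t where t: "t \<in> set ts" "t \<noteq> c" by blast
  obtain as bs where split: "ts = as @ t # bs" using t(1) by (auto simp: in_set_conv_decomp)
  have "g c + D c * (t - c) < g t" using tangent t ts(2) c by blast
  moreover have "sum_list (map (\<lambda>t. g c + D c * (t - c)) as) \<le> sum_list (map g as)"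
    "sum_list (map (\<lambda>t. g c + D c * (t - c)) bs) \<le> sum_list (map g bs)"
    using le by (intro sum_list_mono; simp add: split)+
  ultimately have "n * g c < sum_list (map g ts)" unfolding eq split by simp
  then show "length ts * g (sum_list ts / length ts) < sum_list (map g ts)" by (simp add: n_def c_def)
qed

text \<open>
  The second derivative of \<open>Re F\<close> in direction \<open>u\<close> is \<open>Re (F'' * u\<^sup>2)\<close>, so a square root \<open>u\<close> of \<open>1 / F'' z\<close> makes it
  positive near \<open>z\<close>, and the slope \<open>D\<close> at each point gives a strict tangent inequality. Applied to a branch
  \<open>F\<close> of \<open>log \<phi>\<close>, this is strict convexity of \<open>log \<bar>\<phi>\<bar>\<close> on a short segment.
\<close>

lemma holomorphic_strictly_convex_direction:
  assumes hol: "F holomorphic_on U" and "open U" and z: "z \<in> U" and nz: "deriv (deriv F) z \<noteq> 0"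
  obtains u :: complex and \<eta> :: real and D :: "real \<Rightarrow> real" where "u \<noteq> 0" "0 < \<eta>"
    "\<And>t. t \<in> {0..\<eta>} \<Longrightarrow> z + of_real t * u \<in> U"
    "\<And>t c. t \<in> {0..\<eta>} \<Longrightarrow> c \<in> {0..\<eta>} \<Longrightarrow> t \<noteq> c \<Longrightarrow>
      Re (F (z + of_real c * u)) + D c * (t - c) < Re (F (z + of_real t * u))"
proof -
  define u where "u = csqrt (inverse (deriv (deriv F) z))"
  have u: "u \<noteq> 0" "deriv (deriv F) z * u\<^sup>2 = 1" using nz by (simp_all add: u_def)
  have hol1: "deriv F holomorphic_on U" and hol2: "deriv (deriv F) holomorphic_on U"
    using hol \<open>open U\<close> by (simp_all add: holomorphic_deriv)
  have d1: "(F has_field_derivative deriv F w) (at w)"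
    and d2: "(deriv F has_field_derivative deriv (deriv F) w) (at w)" if "w \<in> U" for w
    using hol hol1 \<open>open U\<close> that by (auto intro: holomorphic_derivI)
  have "isCont (deriv (deriv F)) z"
    using holomorphic_on_imp_continuous_on[OF hol2] \<open>open U\<close> z continuous_on_eq_continuous_at by blast
  then have "(\<lambda>w. Re (deriv (deriv F) w * u\<^sup>2)) \<midarrow>z\<rightarrow> Re (deriv (deriv F) z * u\<^sup>2)"
    unfolding isCont_def by (intro tendsto_intros)
  then have "((\<lambda>w. Re (deriv (deriv F) w * u\<^sup>2)) \<longlongrightarrow> Re (deriv (deriv F) z * u\<^sup>2)) (nhds z)"
    by (rule iffD1[OF tendsto_at_iff_tendsto_nhds])
  then have "eventually (\<lambda>w. 0 < Re (deriv (deriv F) w * u\<^sup>2)) (nhds z)"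
    by (rule order_tendstoD(1)) (unfold u(2), simp)
  moreover have "eventually (\<lambda>w. w \<in> U) (nhds z)"
    using \<open>open U\<close> z by (simp add: eventually_nhds_in_open)
  ultimately have "eventually (\<lambda>w. w \<in> U \<and> 0 < Re (deriv (deriv F) w * u\<^sup>2)) (nhds z)"
    by eventually_elim simp
  then obtain \<epsilon> where \<epsilon>: "0 < \<epsilon>"
    "\<And>w. dist w z < \<epsilon> \<Longrightarrow> w \<in> U \<and> 0 < Re (deriv (deriv F) w * u\<^sup>2)"
    by (auto simp: eventually_nhds_metric)
  define \<eta> where "\<eta> = \<epsilon> / (2 * cmod u)"
  have \<eta>: "0 < \<eta>" using u \<epsilon> by (simp add: \<eta>_def)
  have near: "dist (z + of_real t * u) z < \<epsilon>" if "t \<in> {0..\<eta>}" for t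
  proof -
    have "dist (z + of_real t * u) z = t * cmod u" using that by (simp add: dist_norm norm_mult)
    also have "\<dots> \<le> \<eta> * cmod u" using that by (intro mult_right_mono) auto
    also have "\<dots> < \<epsilon>" using u \<epsilon> by (simp add: \<eta>_def)
    finally show ?thesis .
  qed
  define g g1 where "g t = Re (F (z + of_real t * u))" and "g1 t = Re (deriv F (z + of_real t * u) * u)"
    for t :: real
  have line: "((\<lambda>t. z + complex_of_real t * u) has_vector_derivative u) (at t)" for t
    by (auto intro!: derivative_eq_intros simp: has_vector_derivative_def scaleR_conv_of_real)
  have g: "(g has_real_derivative g1 t) (at t)" if "t \<in> {0..\<eta>}" for t
  proof -
    have "((F \<circ> (\<lambda>t. z + complex_of_real t * u)) has_vector_derivative (u * deriv F (z + of_real t * u))) (at t)"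
      using near[OF that] \<epsilon> by (intro field_vector_diff_chain_at line d1) auto
    from bounded_linear.has_vector_derivative[OF bounded_linear_Re this] show ?thesis
      by (simp add: g_def[abs_def] g1_def o_def has_real_derivative_iff_has_vector_derivative mult.commute)
  qed
  have g1: "(g1 has_real_derivative Re (deriv (deriv F) (z + of_real t * u) * u\<^sup>2)) (at t)"
    if "t \<in> {0..\<eta>}" for t
  proof -
    have "((deriv F \<circ> (\<lambda>t. z + complex_of_real t * u)) has_vector_derivative
        (u * deriv (deriv F) (z + of_real t * u))) (at t)"
      using near[OF that] \<epsilon> by (intro field_vector_diff_chain_at line d2) auto
    then have "((\<lambda>t. (deriv F \<circ> (\<lambda>t. z + complex_of_real t * u)) t * u) has_vector_derivative
        (u * deriv (deriv F) (z + of_real t * u)) * u) (at t)"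
      by (rule has_vector_derivative_mult_left)
    from bounded_linear.has_vector_derivative[OF bounded_linear_Re this] show ?thesis
      by (simp add: g1_def[abs_def] o_def has_real_derivative_iff_has_vector_derivative
          power2_eq_square mult_ac)
  qed
  have mono: "g1 s < g1 t" if "s < t" "s \<in> {0..\<eta>}" "t \<in> {0..\<eta>}" for s t
  proof (rule DERIV_pos_imp_increasing[OF \<open>s < t\<close>])
    fix x assume "s \<le> x" "x \<le> t"
    then have "x \<in> {0..\<eta>}" using that by auto
    with g1 near \<epsilon> show "\<exists>y. DERIV g1 x :> y \<and> y > 0" by blast
  qed
  have tangent: "g c + g1 c * (t - c) < g t"
    if tc: "t \<in> {0..\<eta>}" "c \<in> {0..\<eta>}" "t \<noteq> c" for t c
  proof (cases "c < t")
    case True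
    obtain x where x: "c < x" "x < t" "g t - g c = (t - c) * g1 x"
      using MVT2[OF True, of g g1] g tc by auto
    have "(t - c) * g1 c < (t - c) * g1 x" using mono[of c x] x tc True by simp
    then show ?thesis using x by (simp add: algebra_simps)
  next
    case False
    then have "t < c" using tc by simp
    obtain x where x: "t < x" "x < c" "g c - g t = (c - t) * g1 x"
      using MVT2[OF \<open>t < c\<close>, of g g1] g tc by auto
    have "(c - t) * g1 x < (c - t) * g1 c" using mono[of x c] x tc \<open>t < c\<close> by simp
    then show ?thesis using x by (simp add: algebra_simps)
  qed
  show ?thesis
    using that[OF u(1) \<eta>, of g1] near \<epsilon>(2) tangent by (simp add: g_def)
qed

text \<open>
  The only obstruction to finding a direction of strict convexity: a logarithm with vanishing second derivative
  is affine, and the identity theorem spreads this from the disc to the whole plane.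
\<close>

lemma exponential_if_log_affine:
  assumes hol: "\<phi> holomorphic_on UNIV" and ball: "0 < \<rho>"
    and F: "F holomorphic_on ball z0 \<rho>" "\<And>z. z \<in> ball z0 \<rho> \<Longrightarrow> \<phi> z = exp (F z)"
    and zero: "\<And>z. z \<in> ball z0 \<rho> \<Longrightarrow> deriv (deriv F) z = 0"
  obtains a b where "\<And>z. \<phi> z = exp (a * z + b)"
proof -
  let ?B = "ball z0 \<rho>"
  have hol1: "deriv F holomorphic_on ?B" using F(1) by (simp add: holomorphic_deriv)
  have "\<exists>a. \<forall>z\<in>?B. deriv F z = a"
    using holomorphic_derivI[OF hol1] zero
    by (intro has_field_derivative_zero_constant) (auto intro: has_field_derivative_at_within)
  then obtain a where a: "\<And>z. z \<in> ?B \<Longrightarrow> deriv F z = a" by blast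
  have "\<exists>b. \<forall>z\<in>?B. F z - a * z = b"
  proof (rule has_field_derivative_zero_constant)
    fix z assume z: "z \<in> ?B"
    have "(F has_field_derivative a) (at z within ?B)"
      using holomorphic_derivI[OF F(1) open_ball z] a[OF z] by (simp add: has_field_derivative_at_within)
    then show "((\<lambda>z. F z - a * z) has_field_derivative 0) (at z within ?B)"
      by (auto intro!: derivative_eq_intros)
  qed simp
  then obtain b where b: "\<And>z. z \<in> ?B \<Longrightarrow> F z = a * z + b" by (metis diff_add_cancel add.commute)
  have "\<phi> z = exp (a * z + b)" for z
    by (rule analytic_continuation_open[of ?B UNIV \<phi>])
      (use hol ball F(2) b in \<open>auto intro!: holomorphic_intros\<close>)
  then show ?thesis by (rule that)
qed

lemma sum_list_affine:
  fixes z u :: complex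
  shows "sum_list (map (\<lambda>t. z + of_real t * u) ts) = of_nat (length ts) * z + of_real (sum_list ts) * u"
  by (induction ts) (simp_all add: algebra_simps)

lemma power_le_prod_list:
  fixes f :: "'b \<Rightarrow> real"
  assumes "0 \<le> c" "\<And>x. x \<in> set xs \<Longrightarrow> c \<le> f x"
  shows "c ^ length xs \<le> prod_list (map f xs)"
  using assms(2)
proof (induction xs)
  case (Cons x xs)
  then have "c \<le> f x" "c ^ length xs \<le> prod_list (map f xs)" by auto
  moreover have "0 \<le> f x" using \<open>c \<le> f x\<close> assms(1) by simp
  ultimately show ?case using assms(1) by (simp add: mult_mono)
qed simp

lemma norm_sum_list_le:
  fixes f :: "'b \<Rightarrow> complex" and C :: real
  assumes "\<And>x. x \<in> set xs \<Longrightarrow> cmod (f x) \<le> C"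
  shows "cmod (sum_list (map f xs)) \<le> length xs * C"
  using assms
proof (induction xs)
  case (Cons x xs)
  have "cmod (sum_list (map f (x # xs))) \<le> cmod (f x) + cmod (sum_list (map f xs))"
    by (simp add: norm_triangle_ineq)
  also have "\<dots> \<le> C + length xs * C" using Cons by (intro add_mono) auto
  finally show ?case by (simp add: algebra_simps)
qed simp

lemma prod_list_exp:
  fixes f :: "'b \<Rightarrow> real"
  shows "prod_list (map (\<lambda>x. exp (f x)) xs) = exp (sum_list (map f xs))"
  by (induction xs) (simp_all add: exp_add)

lemma islimpt_segment:
  fixes a u :: complex
  assumes "u \<noteq> 0" "0 < \<eta>" "\<And>t. 0 < t \<Longrightarrow> t < \<eta> \<Longrightarrow> a + of_real t * u \<in> S"
  shows "a islimpt S"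
  unfolding islimpt_approachable
proof (intro allI impI)
  fix e :: real assume "0 < e"
  define t where "t = min \<eta> (e / cmod u) / 2"
  have t: "0 < t" "t < \<eta>" "t < e / cmod u" using assms \<open>0 < e\<close> by (auto simp: t_def min_def divide_simps)
  then have "dist (a + of_real t * u) a < e" using assms(1) by (simp add: dist_norm norm_mult field_simps)
  then show "\<exists>x'\<in>S. x' \<noteq> a \<and> dist x' a < e"
    using assms(1) t(1) assms(3)[OF t(1,2)] by (intro bexI[of _ "a + of_real t * u"]) simp_all
qed

section \<open>Parameters for growing eigenvectors\<close>

text \<open>
  The data needed to steer monomials of degree \<open>m\<close>. The set \<open>\<Lambda>0\<close> indexes eigenvectors used to approximate a
  prescribed point, \<open>\<Lambda>1\<close> those used to approximate a prescribed target, and \<open>1 / \<omega> v\<close> is the factor by which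
  the coefficient of \<open>E (v / m)\<close> shrinks from one iterate to the next, so that the \<open>m\<close>-th power of that summand
  regains exactly \<open>\<omega> v ^ m = \<phi> v\<close>. The four inequalities say that a product of eigenvectors decays under
  iteration when it has no factor from \<open>\<Lambda>1\<close>, when it has between \<open>1\<close> and \<open>m - 1\<close> of them, that it does not
  grow when it has \<open>m\<close> of them, and that it decays when these \<open>m\<close> factors are not all equal. The slack \<open>\<kappa> > 1\<close>
  leaves room for perturbing the coefficients.
\<close>

definition growth_parameters ::
  "(complex \<Rightarrow> complex) \<Rightarrow> nat \<Rightarrow> real \<Rightarrow> complex set \<Rightarrow> complex set \<Rightarrow> (complex \<Rightarrow> complex) \<Rightarrow> bool" where
  "growth_parameters \<phi> m \<kappa> \<Lambda>0 \<Lambda>1 \<omega> \<longleftrightarrow>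
     (\<forall>v\<in>\<Lambda>1. \<omega> v ^ m = \<phi> v \<and> \<kappa> < cmod (\<omega> v)) \<and>
     (\<forall>ws. ws \<noteq> [] \<and> set ws \<subseteq> \<Lambda>0 \<and> length ws \<le> m \<longrightarrow> cmod (\<phi> (sum_list ws)) < 1) \<and>
     (\<forall>ws vs. set ws \<subseteq> \<Lambda>0 \<and> set vs \<subseteq> \<Lambda>1 \<and> vs \<noteq> [] \<and> length vs < m \<and> length ws \<le> m \<longrightarrow>
        \<kappa> ^ length vs * cmod (\<phi> (sum_list ws + sum_list vs / of_nat m))
          < prod_list (map (\<lambda>v. cmod (\<omega> v)) vs)) \<and>
     (\<forall>vs. set vs \<subseteq> \<Lambda>1 \<and> length vs = m \<longrightarrow>
        cmod (\<phi> (sum_list vs / of_nat m)) \<le> prod_list (map (\<lambda>v. cmod (\<omega> v)) vs)) \<and>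
     (\<forall>vs. set vs \<subseteq> \<Lambda>1 \<and> length vs = m \<and> (\<nexists>v. set vs \<subseteq> {v}) \<longrightarrow>
        cmod (\<phi> (sum_list vs / of_nat m)) < prod_list (map (\<lambda>v. cmod (\<omega> v)) vs))"

text \<open>
  Let \<open>z0\<close> be the point of the ray at the first maximiser of \<open>\<bar>\<phi>\<bar> powr (1 / t)\<close>. The inequalities for fewer than
  \<open>m\<close> growing factors are strict at \<open>z0\<close> itself, hence survive on a small disc around \<open>z0\<close> and under adding a
  small sum of parameters from \<open>\<Lambda>0\<close>. Inside that disc \<open>\<Lambda>1\<close> is a segment on which \<open>log \<bar>\<phi>\<bar>\<close> is strictly convex;
  Jensen's inequality then settles the case of \<open>m\<close> factors. Such a segment exists because \<open>\<phi>\<close> is not of the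
  form \<open>exp (a z + b)\<close>: with \<open>\<bar>\<phi> 0\<bar> = 1\<close> such a function would be below \<open>1\<close> on the whole ray or nowhere on it.
  The set \<open>\<Lambda>0\<close> is a piece of the ray so short that sums of \<open>m\<close> of its points stay where \<open>\<bar>\<phi>\<bar> < 1\<close>.
\<close>

lemma growth_parameters_exist:
  fixes \<phi> :: "complex \<Rightarrow> complex" and m :: nat
  assumes hol: "\<phi> holomorphic_on UNIV" and phi0: "cmod (\<phi> 0) = 1" and pos: "0 < r" "0 < R"
    and small: "\<And>t. 0 < t \<Longrightarrow> t < r \<Longrightarrow> cmod (\<phi> (of_real t * cis \<theta>)) < 1"
    and large: "1 < cmod (\<phi> (of_real R * cis \<theta>))" and m: "0 < m"
  obtains \<kappa> \<Lambda>0 \<Lambda>1 a0 a1 \<omega> where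
    "1 < \<kappa>" "a0 islimpt \<Lambda>0" "a1 islimpt \<Lambda>1" "growth_parameters \<phi> m \<kappa> \<Lambda>0 \<Lambda>1 \<omega>"
proof -
  have cont: "isCont \<phi> z" for z
    using holomorphic_on_imp_continuous_on[OF hol] continuous_on_eq_continuous_at[OF open_UNIV] by blast
  define g where "g t = cmod (\<phi> (of_real t * cis \<theta>))" for t
  have contg: "continuous_on UNIV g"
    unfolding g_def[abs_def]
    by (intro continuous_on_norm continuous_on_compose2[OF holomorphic_on_imp_continuous_on[OF hol]]
        continuous_intros) auto
  have g_bounds: "0 \<le> g t" "0 < t \<Longrightarrow> t < r \<Longrightarrow> g t < 1" "1 < g R" for t
    using small large by (simp_all add: g_def)
  obtain t0 where t0: "0 < t0" "1 < g t0" "\<And>s. 0 < s \<Longrightarrow> s < 1 \<Longrightarrow> g (s * t0) < g t0 powr s"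
    using least_maximiser_of_root_growth[OF contg g_bounds(1) pos g_bounds(2,3)] by blast
  define z0 where "z0 = of_real t0 * cis \<theta>"
  define A where "A = g t0 powr (1 / m)"
  have A: "1 < A" "A ^ m = g t0"
    using t0 m by (auto simp: A_def gr_one_powr powr_powr simp flip: powr_realpow)
  have scaled: "cmod (\<phi> (of_real (j / m) * z0)) < A ^ j" if "j \<in> {1..<m}" for j :: nat
  proof -
    have "cmod (\<phi> (of_real (j / m) * z0)) = g (j / m * t0)" by (simp add: g_def z0_def mult_ac)
    also have "\<dots> < g t0 powr (j / m)" using that by (intro t0) auto
    also have "\<dots> = A ^ j" using t0(2) by (simp add: A_def powr_powr flip: powr_realpow)
    finally show ?thesis .
  qed
  \<comment> \<open>The strict inequalities are finitely many, so they still hold for some \<open>b < A\<close>; the point \<open>c\<close>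
      between \<open>b\<close> and \<open>A\<close> turns the gap into the slack \<open>\<kappa> = c / b\<close>.\<close>
  have "eventually (\<lambda>b. \<forall>j\<in>{1..<m}. cmod (\<phi> (of_real (j / m) * z0)) < b ^ j) (at_left A)"
  proof (intro eventually_ball_finite ballI)
    fix j assume "j \<in> {1..<m}"
    moreover have "((\<lambda>b. b ^ j) \<longlongrightarrow> A ^ j) (at_left A)" by (intro tendsto_intros)
    ultimately show "eventually (\<lambda>b. cmod (\<phi> (of_real (j / m) * z0)) < b ^ j) (at_left A)"
      using scaled order_tendstoD(1) by blast
  qed simp
  moreover have "eventually (\<lambda>b. b \<in> {1<..<A}) (at_left A)"
    using A(1) eventually_at_left_real by blast
  ultimately have "eventually (\<lambda>b. b \<in> {1<..<A} \<and> (\<forall>j\<in>{1..<m}. cmod (\<phi> (of_real (j / m) * z0)) < b ^ j)) (at_left A)"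
    by eventually_elim simp
  then obtain b where b: "1 < b" "b < A"
      "\<And>j. j \<in> {1..<m} \<Longrightarrow> cmod (\<phi> (of_real (j / m) * z0)) < b ^ j"
    using eventually_happens'[OF trivial_limit_at_left_real] by fastforce
  define c \<kappa> where "c = (b + A) / 2" and "\<kappa> = c / b"
  have c: "b < c" "c < A" "1 < \<kappa>" "\<kappa> < c" "\<kappa> * b = c"
  proof -
    show bc: "b < c" "c < A" using b(2) by (simp_all add: c_def)
    show "1 < \<kappa>" "\<kappa> * b = c" using b(1) bc by (simp_all add: \<kappa>_def)
    show "\<kappa> < c" using b(1) bc by (simp add: \<kappa>_def divide_less_eq)
  qed
  have nbhd: "eventually (\<lambda>d. \<forall>w. dist w x < d \<longrightarrow> Q w) (at_right 0)" if Q: "eventually Q (nhds x)"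
    for Q and x :: complex
  proof -
    obtain d0 where d0: "0 < d0" "\<And>w. dist w x < d0 \<Longrightarrow> Q w" using Q by (auto simp: eventually_nhds_metric)
    have "eventually (\<lambda>d. d \<in> {0<..<d0}) (at_right 0)" using d0(1) by (rule eventually_at_right_real)
    then show ?thesis by eventually_elim (use d0(2) in auto)
  qed
  have lim: "((\<lambda>w. cmod (\<phi> w)) \<longlongrightarrow> cmod (\<phi> x)) (nhds x)" for x
    using tendsto_norm[OF cont[of x, unfolded isCont_def]] tendsto_at_iff_tendsto_nhds[of "\<lambda>w. cmod (\<phi> w)" x] by simp
  have "cmod (\<phi> z0) > c ^ m"
    using A c b m power_strict_mono[of c A m] by (simp add: g_def z0_def)
  then have "eventually (\<lambda>w. c ^ m < cmod (\<phi> w)) (nhds z0)" by (rule order_tendstoD(1)[OF lim])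
  then have "eventually (\<lambda>d. \<forall>w. dist w z0 < d \<longrightarrow> c ^ m < cmod (\<phi> w)) (at_right 0)" by (rule nbhd)
  moreover have "eventually (\<lambda>d. \<forall>j\<in>{1..<m}. \<forall>w. dist w (of_real (j / m) * z0) < d \<longrightarrow> cmod (\<phi> w) < b ^ j) (at_right 0)"
    by (intro eventually_ball_finite ballI nbhd order_tendstoD(2)[OF lim] b) auto
  moreover have "eventually (\<lambda>d. d \<in> {0<..<1}) (at_right (0::real))" by (rule eventually_at_right_real) simp
  ultimately have "eventually (\<lambda>d. 0 < d \<and> (\<forall>w. dist w z0 < d \<longrightarrow> c ^ m < cmod (\<phi> w)) \<and>
      (\<forall>j\<in>{1..<m}. \<forall>w. dist w (of_real (j / m) * z0) < d \<longrightarrow> cmod (\<phi> w) < b ^ j)) (at_right 0)"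
    by eventually_elim auto
  then obtain d where d: "0 < d" "\<And>w. dist w z0 < d \<Longrightarrow> c ^ m < cmod (\<phi> w)"
      "\<And>j w. j \<in> {1..<m} \<Longrightarrow> dist w (of_real (j / m) * z0) < d \<Longrightarrow> cmod (\<phi> w) < b ^ j"
    using eventually_happens'[OF trivial_limit_at_right_real] by blast
  define U where "U = ball z0 (d / 2)"
  have phiU: "c ^ m < cmod (\<phi> z)" if "z \<in> U" for z
    using d(2)[of z] that d(1) by (auto simp: U_def dist_commute)
  have "\<phi> z \<noteq> 0" if "z \<in> U" for z
    using phiU[OF that] b c by (auto simp: not_less intro!: zero_le_power)
  then obtain F where F: "F holomorphic_on U" "\<And>z. z \<in> U \<Longrightarrow> \<phi> z = exp (F z)"
    using contractible_imp_holomorphic_log[OF holomorphic_on_subset[OF hol], of U]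
    by (auto simp: U_def convex_imp_contractible)
  have "\<exists>z\<in>U. deriv (deriv F) z \<noteq> 0"
  proof (rule ccontr)
    assume "\<not> ?thesis"
    then obtain p q where pq: "\<And>z. \<phi> z = exp (p * z + q)"
      using exponential_if_log_affine[OF hol _ F[unfolded U_def]] d(1) unfolding U_def by fastforce
    have g: "g t = exp (t * Re (p * cis \<theta>))" for t
      using phi0 by (simp add: g_def pq algebra_simps)
    show False
      using g_bounds(2)[of "r / 2"] g_bounds(3) pos by (simp add: g mult_less_0_iff zero_less_mult_iff)
  qed
  then obtain z1 where z1: "z1 \<in> U" "deriv (deriv F) z1 \<noteq> 0" by blast
  obtain u \<eta> D where u: "u \<noteq> 0" and \<eta>: "0 < \<eta>"
    and inU: "\<And>t. t \<in> {0..\<eta>} \<Longrightarrow> z1 + of_real t * u \<in> U"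
    and tangent: "\<And>t c. t \<in> {0..\<eta>} \<Longrightarrow> c \<in> {0..\<eta>} \<Longrightarrow> t \<noteq> c \<Longrightarrow>
      Re (F (z1 + of_real c * u)) + D c * (t - c) < Re (F (z1 + of_real t * u))"
    using holomorphic_strictly_convex_direction[OF F(1) _ z1] by (auto simp: U_def)
  define \<Lambda>1 where "\<Lambda>1 = (\<lambda>t. z1 + of_real t * u) ` {0..\<eta>}"
  define \<Lambda>0 where "\<Lambda>0 = (\<lambda>t. of_real t * cis \<theta>) ` {0<..<min r (d / 2) / m}"
  define \<omega> where "\<omega> v = exp (F v / of_nat m)" for v
  have \<Lambda>1: "\<Lambda>1 \<subseteq> U" using inU by (auto simp: \<Lambda>1_def)
  have \<omega>: "\<omega> v ^ m = \<phi> v" if "v \<in> \<Lambda>1" for v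
    using that \<Lambda>1 F(2) m by (auto simp: \<omega>_def simp flip: exp_of_nat_mult)
  have c\<omega>: "c < cmod (\<omega> v)" if "v \<in> \<Lambda>1" for v
  proof -
    have "c ^ m < cmod (\<omega> v) ^ m" using phiU[of v] \<omega>[OF that] that \<Lambda>1 by (auto simp flip: norm_power)
    then show ?thesis by (rule power_less_imp_less_base) simp
  qed
  have norm_\<Lambda>0: "cmod l \<le> d / 2 / m" if "l \<in> \<Lambda>0" for l
    using that m by (auto simp: \<Lambda>0_def norm_mult field_simps)
  have top: "cmod (\<phi> (sum_list vs / of_nat m)) \<le> prod_list (map (\<lambda>v. cmod (\<omega> v)) vs)"
    "(\<nexists>v. set vs \<subseteq> {v}) \<Longrightarrow> cmod (\<phi> (sum_list vs / of_nat m)) < prod_list (map (\<lambda>v. cmod (\<omega> v)) vs)"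
    if vs: "set vs \<subseteq> \<Lambda>1" "length vs = m" for vs
  proof -
    have "vs \<in> map (\<lambda>t. z1 + of_real t * u) ` lists {0..\<eta>}"
      using vs(1) unfolding \<Lambda>1_def by (auto simp: lists_image[symmetric])
    then obtain ts where ts: "set ts \<subseteq> {0..\<eta>}" "vs = map (\<lambda>t. z1 + of_real t * u) ts" by auto
    have len: "length ts = m" "ts \<noteq> []" using vs(2) ts(2) m by auto
    define G where "G t = Re (F (z1 + of_real t * u))" for t
    note J = strict_jensen_of_tangents[of 0 \<eta> G D, OF _ len(2) ts(1), unfolded G_def, OF tangent, folded G_def]
    define s where "s = sum_list ts / m"
    have "s \<in> {0..\<eta>}" using mean_in_interval[OF len(2) ts(1)] by (simp add: s_def len)
    have "sum_list vs / of_nat m = z1 + of_real s * u"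
      unfolding ts(2) sum_list_affine len s_def using m by (simp add: field_simps)
    then have L: "cmod (\<phi> (sum_list vs / of_nat m)) = exp (G s)"
      using F(2) inU \<open>s \<in> {0..\<eta>}\<close> by (simp add: G_def)
    have "prod_list (map (\<lambda>v. cmod (\<omega> v)) vs) = prod_list (map (\<lambda>t. exp (G t / m)) ts)"
      by (simp add: ts(2) \<omega>_def o_def G_def)
    also have "\<dots> = exp (sum_list (map G ts) / m)"
      by (simp add: prod_list_exp divide_inverse sum_list_mult_const)
    finally have P: "prod_list (map (\<lambda>v. cmod (\<omega> v)) vs) = exp (sum_list (map G ts) / m)" .
    show "cmod (\<phi> (sum_list vs / of_nat m)) \<le> prod_list (map (\<lambda>v. cmod (\<omega> v)) vs)"
      using J(1) m by (simp add: L P len s_def field_simps)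
    assume "\<nexists>v. set vs \<subseteq> {v}"
    then have "\<nexists>t. set ts \<subseteq> {t}" by (auto simp: ts(2))
    then show "cmod (\<phi> (sum_list vs / of_nat m)) < prod_list (map (\<lambda>v. cmod (\<omega> v)) vs)"
      using J(2) m by (simp add: L P len s_def field_simps)
  qed
  have base: "cmod (\<phi> (sum_list ws)) < 1"
    if ws: "set ws \<subseteq> \<Lambda>0" "length ws \<le> m" "ws \<noteq> []" for ws
  proof -
    have "ws \<in> map (\<lambda>t. of_real t * cis \<theta>) ` lists {0<..<min r (d / 2) / m}"
      using ws(1) unfolding \<Lambda>0_def by (auto simp: lists_image[symmetric])
    then obtain ts where ts: "set ts \<subseteq> {0<..<min r (d / 2) / m}" "ws = map (\<lambda>t. of_real t * cis \<theta>) ts" by auto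
    have "sum_list ws = of_real (sum_list ts) * cis \<theta>"
      using sum_list_affine[of 0 "cis \<theta>" ts] by (simp add: ts(2))
    moreover obtain t ts' where split: "ts = t # ts'" using \<open>ws \<noteq> []\<close> ts(2) by (cases ts) auto
    have "0 \<le> sum_list ts'" using ts(1) by (intro sum_list_nonneg) (auto simp: split)
    then have "0 < sum_list ts" using ts(1) by (simp add: split)
    moreover have "sum_list ts < r"
    proof -
      have "sum_list ts' \<le> length ts' * (r / m)"
        using sum_list_mono[of ts' "\<lambda>t. t" "\<lambda>t. r / m"] ts(1) m
        by (force simp: split sum_list_triv field_simps)
      moreover have "t < r / m" using ts(1) m by (auto simp: split field_simps)
      ultimately have "sum_list ts < length ts * (r / m)" by (simp add: split algebra_simps)
      also have "\<dots> \<le> m * (r / m)" using ws(2) pos ts(2) by (intro mult_right_mono) auto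
      finally show ?thesis using m by simp
    qed
    ultimately show ?thesis using small by simp
  qed
  have mixed: "\<kappa> ^ length vs * cmod (\<phi> (sum_list ws + sum_list vs / of_nat m))
      < prod_list (map (\<lambda>v. cmod (\<omega> v)) vs)"
    if ws: "set ws \<subseteq> \<Lambda>0" "length ws \<le> m" and vs: "set vs \<subseteq> \<Lambda>1" "vs \<noteq> []" "length vs < m" for ws vs
  proof -
    have norm_ws: "cmod (sum_list ws) \<le> d / 2"
    proof -
      have "cmod (sum_list (map (\<lambda>x. x) ws)) \<le> length ws * (d / 2 / m)"
        using ws(1) norm_\<Lambda>0 by (intro norm_sum_list_le) auto
      also have "\<dots> \<le> m * (d / 2 / m)" using ws(2) d(1) by (intro mult_right_mono) auto
      finally show ?thesis using m by simp
    qed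
    let ?j = "length vs"
    have "cmod (sum_list (map (\<lambda>v. v - z0) vs)) \<le> ?j * (d / 2)"
      using vs(1) \<Lambda>1 by (intro norm_sum_list_le) (auto simp: U_def dist_norm norm_minus_commute less_imp_le)
    also have "\<dots> < m * (d / 2)" using vs(3) d(1) by simp
    finally have "cmod (sum_list (map (\<lambda>v. v - z0) vs) / m) < d / 2" using m by (simp add: norm_divide field_simps)
    moreover have "sum_list (map (\<lambda>v. v - z0) vs) = sum_list vs - of_nat ?j * z0"
      by (induction vs) (simp_all add: algebra_simps)
    ultimately have "dist (sum_list ws + sum_list vs / of_nat m) (of_real (?j / m) * z0) < d"
      using norm_ws norm_triangle_ineq[of "sum_list ws" "sum_list vs / of_nat m - of_real (?j / m) * z0"]
      by (simp add: dist_norm diff_divide_distrib add_diff_eq)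
    then have "cmod (\<phi> (sum_list ws + sum_list vs / of_nat m)) < b ^ ?j"
      using vs by (intro d(3)) (auto simp: Suc_le_eq)
    then have "\<kappa> ^ ?j * cmod (\<phi> (sum_list ws + sum_list vs / of_nat m)) < \<kappa> ^ ?j * b ^ ?j"
      using c by simp
    also have "\<dots> = c ^ ?j" using c by (simp flip: power_mult_distrib)
    also have "\<dots> \<le> prod_list (map (\<lambda>v. cmod (\<omega> v)) vs)"
      using vs(1) c\<omega> b c by (intro power_le_prod_list) (auto intro: less_imp_le)
    finally show ?thesis .
  qed
  show ?thesis
  proof (rule that[of \<kappa> 0 \<Lambda>0 z1 \<Lambda>1 \<omega>])
    show "0 islimpt \<Lambda>0"
      by (rule islimpt_segment[of "cis \<theta>" "min r (d / 2) / m"]) (use pos d m in \<open>auto simp: \<Lambda>0_def\<close>)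
    show "z1 islimpt \<Lambda>1"
      by (rule islimpt_segment[OF u \<eta>]) (auto simp: \<Lambda>1_def)
    have "\<kappa> < cmod (\<omega> v)" if "v \<in> \<Lambda>1" for v using c\<omega>[OF that] c by simp
    then show "growth_parameters \<phi> m \<kappa> \<Lambda>0 \<Lambda>1 \<omega>"
      unfolding growth_parameters_def using \<omega> base mixed top by blast
  qed (rule c)
qed

section \<open>Eigenvectors closed under multiplication\<close>

lemma sum_set_Cons:
  "sum f (set_Cons A B) = (\<Sum>a\<in>A. \<Sum>bs\<in>B. f (a # bs))"
proof -
  have "set_Cons A B = (\<lambda>(a, bs). a # bs) ` (A \<times> B)" by (auto simp: set_Cons_def)
  then have "sum f (set_Cons A B) = (\<Sum>(a, bs)\<in>A \<times> B. f (a # bs))"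
    by (simp add: sum.reindex inj_on_def split_def)
  then show ?thesis by (simp add: sum.cartesian_product)
qed

lemma finite_listset: "(\<And>A. A \<in> set As \<Longrightarrow> finite A) \<Longrightarrow> finite (listset As)"
proof (induction As)
  case (Cons A As)
  have "set_Cons A (listset As) = (\<lambda>(a, bs). a # bs) ` (A \<times> listset As)" by (auto simp: set_Cons_def)
  with Cons show ?case by simp
qed simp

lemma in_listset_map_iff:
  "ks \<in> listset (map K xs) \<longleftrightarrow> list_all2 (\<lambda>i k. k \<in> K i) xs ks"
  by (induction xs arbitrary: ks) (auto simp: set_Cons_def list_all2_Cons1)

lemma norm_prod_list:
  fixes f :: "'b \<Rightarrow> complex"
  shows "cmod (prod_list (map f xs)) = prod_list (map (\<lambda>x. cmod (f x)) xs)"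
  by (induction xs) (simp_all add: norm_mult)

lemma prod_list_pos:
  fixes f :: "'b \<Rightarrow> real"
  shows "(\<And>x. x \<in> set xs \<Longrightarrow> 0 < f x) \<Longrightarrow> 0 < prod_list (map f xs)"
  by (induction xs) simp_all

lemma prod_list_mult_power:
  fixes a b :: "'b \<Rightarrow> complex"
  shows "prod_list (map (\<lambda>p. a p * b p ^ n) ps) = prod_list (map a ps) * prod_list (map b ps) ^ n"
  by (induction ps) (simp_all add: power_mult_distrib algebra_simps)

context comm_F_algebra
begin

lemma tendsto_smul:
  assumes "(c \<longlongrightarrow> c0) F" "(x \<longlongrightarrow> x0) F"
  shows "((\<lambda>n. smul (c n) (x n)) \<longlongrightarrow> smul c0 x0) F"
proof -
  have "isCont (\<lambda>(c, x). smul c x) (c0, x0)"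
    using continuous_smul by (simp add: continuous_on_eq_continuous_at)
  from isCont_tendsto_compose[OF this tendsto_Pair[OF assms]] show ?thesis by simp
qed

lemma smul_mult_smul: "smul c x * smul d y = smul (c * d) (x * y)"
  by (metis mult.commute scale_scale smul_mult_left)

end

locale exponential_eigenvectors = comm_F_algebra smul
  for smul :: "complex \<Rightarrow> 'a \<Rightarrow>
    'a::{comm_ring, topological_ab_group_add, topological_semigroup_mult, complete_space}" +
  fixes T :: "'a \<Rightarrow> 'a" and E :: "complex \<Rightarrow> 'a" and \<phi> :: "complex \<Rightarrow> complex"
  assumes linear_T: "Vector_Spaces.linear smul smul T"
    and continuous_T: "continuous_on UNIV T"
    and eigenvector: "T (E z) = smul (\<phi> z) (E z)"
    and E_mult: "E z * E w = E (z + w)"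
begin

sublocale T: Vector_Spaces.linear smul smul T by (rule linear_T)

lemma continuous_T_power: "continuous_on UNIV (T ^^ n)"
  by (induction n) (auto intro: continuous_on_compose2[OF continuous_T])

lemma T_power_sum: "(T ^^ n) (sum f A) = (\<Sum>x\<in>A. (T ^^ n) (f x))"
  by (induction n) (simp_all add: T.sum)

lemma T_power_scale: "(T ^^ n) (smul c x) = smul c ((T ^^ n) x)"
  by (induction n) (simp_all add: T.scale)

lemma T_power_eigenvector: "(T ^^ n) (smul c (E z)) = smul (c * \<phi> z ^ n) (E z)"
  by (induction n) (simp_all add: T.scale eigenvector mult_ac)

text \<open>
  Multiplying out: a choice \<open>ks\<close> of one summand per factor contributes a multiple of the single eigenvector at the
  sum of the chosen parameters.
\<close>

lemma nonempty_prod_expansion: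
  fixes c :: "'i \<Rightarrow> 'k \<Rightarrow> complex"
  assumes "xs \<noteq> []"
  shows "nonempty_prod (map (\<lambda>i. \<Sum>k\<in>K i. smul (c i k) (E (\<zeta> k))) xs) =
    (\<Sum>ks\<in>listset (map K xs). smul (prod_list (map (\<lambda>(i, k). c i k) (zip xs ks))) (E (sum_list (map \<zeta> ks))))"
  using assms
proof (induction xs)
  case (Cons x xs)
  show ?case
  proof (cases xs)
    case Nil
    then show ?thesis by (simp add: sum.reindex inj_on_def)
  next
    case (Cons y ys)
    let ?F = "\<lambda>i. \<Sum>k\<in>K i. smul (c i k) (E (\<zeta> k))"
    let ?C = "\<lambda>ks. prod_list (map (\<lambda>(i, k). c i k) (zip xs ks))"
    have "nonempty_prod (map ?F (x # xs)) = ?F x * nonempty_prod (map ?F xs)"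
      by (simp add: Cons)
    also have "\<dots> = (\<Sum>k\<in>K x. \<Sum>ks\<in>listset (map K xs).
        smul (c x k) (E (\<zeta> k)) * smul (?C ks) (E (sum_list (map \<zeta> ks))))"
      using Cons.IH Cons by (simp add: sum_product)
    also have "\<dots> = (\<Sum>k\<in>K x. \<Sum>ks\<in>listset (map K xs).
        smul (c x k * ?C ks) (E (\<zeta> k + sum_list (map \<zeta> ks))))"
      by (simp add: smul_mult_smul E_mult)
    finally show ?thesis by (simp add: sum_set_Cons)
  qed
qed simp

lemma tendsto_zero_of_contracted_eigenvector:
  assumes "cmod q < 1"
  shows "(\<lambda>n. smul (c * q ^ n) (E z)) \<longlonglongrightarrow> 0"
proof -
  have "(\<lambda>n. c * q ^ n) \<longlonglongrightarrow> c * 0" by (intro tendsto_intros LIMSEQ_power_zero assms)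
  from tendsto_smul[OF this tendsto_const, of "E z"] show ?thesis by simp
qed

end

section \<open>Orbits of monomials\<close>

text \<open>
  A summand of a factor is tagged \<open>Inl\<close> if it comes from the approximated point and \<open>Inr\<close> if it is one of the
  small summands that grow under iteration.
\<close>

definition base_parts :: "('b + 'c) list \<Rightarrow> 'b list" where
  "base_parts ks = concat (map (case_sum (\<lambda>l. [l]) (\<lambda>_. [])) ks)"

definition growth_parts :: "('b + 'c) list \<Rightarrow> 'c list" where
  "growth_parts ks = concat (map (case_sum (\<lambda>_. []) (\<lambda>v. [v])) ks)"

text \<open>
  Each summand of the \<open>i\<close>-th factor has the form \<open>c * q ^ n * E \<zeta>\<close> at step \<open>n\<close>; \<open>growth_rate\<close> is the ratio \<open>q\<close> and
  \<open>exponent\<close> the parameter \<open>\<zeta>\<close>. The weights \<open>kap i\<close> treat the factors unequally, which later separates monomials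
  of equal degree.
\<close>

definition growth_rate :: "('i \<Rightarrow> real) \<Rightarrow> (complex \<Rightarrow> complex) \<Rightarrow> 'i \<Rightarrow> complex + complex \<Rightarrow> complex" where
  "growth_rate kap \<omega> i = case_sum (\<lambda>_. 1) (\<lambda>v. of_real (kap i) / \<omega> v)"

definition exponent :: "nat \<Rightarrow> complex + complex \<Rightarrow> complex" where
  "exponent m = case_sum (\<lambda>l. l) (\<lambda>v. v / of_nat m)"

text \<open>
  Whether a term decays depends on a choice of summands only through the parameters it picks from \<open>\<Lambda>0\<close> and
  \<open>\<Lambda>1\<close>. The exact value of the ratio is needed only when every factor contributes a growing summand, where the
  product of all weights appears; otherwise each weight is bounded by \<open>\<kappa>\<close>.
\<close>

lemma choice_parts:
  fixes kap :: "'i \<Rightarrow> real" and \<omega> :: "complex \<Rightarrow> complex" and m :: nat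
  assumes ks: "list_all2 (\<lambda>i k. k \<in> K0 i <+> V) xs ks"
    and K0: "\<And>i. K0 i \<subseteq> \<Lambda>0" and kap: "\<And>i. 0 < kap i" "\<And>i. kap i \<le> \<kappa>" "0 \<le> \<kappa>"
    and \<omega>: "\<forall>v\<in>V. \<omega> v \<noteq> 0"
  defines "ws \<equiv> base_parts ks" and "vs \<equiv> growth_parts ks"
    and "Q \<equiv> prod_list (map (\<lambda>(i, k). growth_rate kap \<omega> i k) (zip xs ks))"
  shows "set ws \<subseteq> \<Lambda>0" "set vs \<subseteq> V" "length ws + length vs = length xs"
    "sum_list (map (exponent m) ks) = sum_list ws + sum_list vs / of_nat m"
    "cmod Q * prod_list (map (\<lambda>v. cmod (\<omega> v)) vs) \<le> \<kappa> ^ length vs"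
    "vs = [] \<Longrightarrow> Q = 1"
    "length vs = length xs \<Longrightarrow> ks = map Inr vs"
    "length vs = length xs \<Longrightarrow> Q * prod_list (map \<omega> vs) = of_real (prod_list (map kap xs))"
proof -
  note defs = base_parts_def growth_parts_def growth_rate_def exponent_def
  have "set (base_parts ks) \<subseteq> \<Lambda>0 \<and> set (growth_parts ks) \<subseteq> V \<and>
      length (base_parts ks) + length (growth_parts ks) = length xs \<and>
      sum_list (map (exponent m) ks) = sum_list (base_parts ks) + sum_list (growth_parts ks) / of_nat m"
    using ks
  proof (induction rule: list_all2_induct)
    case (Cons i js k ks)
    then show ?case using K0 by (cases k) (auto simp: defs add_divide_distrib algebra_simps)
  qed (simp add: defs)
  then show "set ws \<subseteq> \<Lambda>0" "set vs \<subseteq> V" and len: "length ws + length vs = length xs"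
    and "sum_list (map (exponent m) ks) = sum_list ws + sum_list vs / of_nat m"
    by (simp_all add: ws_def vs_def)
  show "cmod Q * prod_list (map (\<lambda>v. cmod (\<omega> v)) vs) \<le> \<kappa> ^ length vs"
    unfolding Q_def vs_def using ks
  proof (induction rule: list_all2_induct)
    case (Cons i js k ks)
    let ?Q = "prod_list (map (\<lambda>(i, k). growth_rate kap \<omega> i k) (zip js ks))"
    let ?P = "prod_list (map (\<lambda>v. cmod (\<omega> v)) (growth_parts ks))"
    show ?case
    proof (cases k)
      case (Inr v)
      have "0 \<le> cmod ?Q * ?P" by (intro mult_nonneg_nonneg prod_list_nonneg) auto
      then have "kap i * (cmod ?Q * ?P) \<le> \<kappa> * \<kappa> ^ length (growth_parts ks)"
        using Cons.IH kap(2,3) by (intro mult_mono)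
      moreover have "v \<in> V" using Cons.hyps Inr by auto
      ultimately show ?thesis
        using Inr \<omega> kap(1)[of i] by (simp add: defs norm_mult norm_divide abs_of_pos)
    qed (use Cons.IH in \<open>simp add: defs\<close>)
  qed (simp add: defs)
  have "growth_parts ks = [] \<longrightarrow> prod_list (map (\<lambda>(i, k). growth_rate kap \<omega> i k) (zip xs ks)) = 1"
    using ks by (induction rule: list_all2_induct) (auto simp: defs split: sum.splits)
  then show "vs = [] \<Longrightarrow> Q = 1" by (simp add: vs_def Q_def)
  have "base_parts ks = [] \<longrightarrow> ks = map Inr (growth_parts ks)"
    by (induction ks) (auto simp: defs split: sum.splits)
  then show pure: "length vs = length xs \<Longrightarrow> ks = map Inr vs"
    using len unfolding ws_def vs_def by simp
  have "ks = map Inr (growth_parts ks) \<longrightarrow> prod_list (map (\<lambda>(i, k). growth_rate kap \<omega> i k) (zip xs ks)) *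
      prod_list (map \<omega> (growth_parts ks)) = of_real (prod_list (map kap xs))"
    using ks
  proof (induction rule: list_all2_induct)
    case (Cons i js k ks)
    then show ?case using \<omega> by (cases k) (auto simp: defs)
  qed (simp add: defs)
  then show "length vs = length xs \<Longrightarrow> Q * prod_list (map \<omega> vs) = of_real (prod_list (map kap xs))"
    using pure unfolding vs_def Q_def by blast
qed

lemma growth_choice_in:
  assumes "list_all2 (\<lambda>i k. k \<in> K0 i <+> V) xs ks" "Inr v \<in> set ks"
  shows "v \<in> V"
  using assms by (induction rule: list_all2_induct) auto

context exponential_eigenvectors
begin

text \<open>
  After multiplying out and applying \<open>T ^^ n\<close>, every term is a constant times the \<open>n\<close>-th power of a fixed ratio,
  times a fixed eigenvector. The inequalities of \<open>growth_parameters\<close> make all these ratios smaller than \<open>1\<close> in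
  modulus, except when \<open>m\<close> copies of the same growing summand are multiplied and the weights cancel; then the ratio
  is exactly \<open>1\<close>, and these terms add up to the limit.
\<close>

lemma monomial_orbit_limit:
  fixes m :: nat and \<kappa> :: real and \<omega> :: "complex \<Rightarrow> complex" and kap :: "'i \<Rightarrow> real"
    and K0 :: "'i \<Rightarrow> complex set" and V :: "complex set"
    and c0 :: "'i \<Rightarrow> complex \<Rightarrow> complex" and d :: "complex \<Rightarrow> complex"
  defines "f \<equiv> \<lambda>n i. (\<Sum>l\<in>K0 i. smul (c0 i l) (E l)) +
      (\<Sum>v\<in>V. smul (d v * (of_real (kap i) / \<omega> v) ^ n) (E (v / of_nat m)))"
  assumes xs: "xs \<noteq> []" "length xs \<le> m"
    and fin: "\<And>i. finite (K0 i)" "finite V" and sub: "\<And>i. K0 i \<subseteq> \<Lambda>0" "V \<subseteq> \<Lambda>1"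
    and kap: "\<And>i. 0 < kap i" "\<And>i. kap i \<le> \<kappa>"
    and kap_top: "length xs = m \<Longrightarrow> prod_list (map kap xs) \<le> 1"
    and growth: "growth_parameters \<phi> m \<kappa> \<Lambda>0 \<Lambda>1 \<omega>"
  shows "(\<lambda>n. (T ^^ n) (nonempty_prod (map (f n) xs))) \<longlonglongrightarrow>
    (if length xs = m \<and> prod_list (map kap xs) = 1 then \<Sum>v\<in>V. smul (d v ^ m) (E v) else 0)"
proof -
  have \<omega>: "\<And>v. v \<in> \<Lambda>1 \<Longrightarrow> \<omega> v ^ m = \<phi> v" "\<And>v. v \<in> \<Lambda>1 \<Longrightarrow> \<kappa> < cmod (\<omega> v)"
    and base: "\<And>ws. ws \<noteq> [] \<Longrightarrow> set ws \<subseteq> \<Lambda>0 \<Longrightarrow> length ws \<le> m \<Longrightarrow> cmod (\<phi> (sum_list ws)) < 1"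
    and mixed: "\<And>ws vs. set ws \<subseteq> \<Lambda>0 \<Longrightarrow> set vs \<subseteq> \<Lambda>1 \<Longrightarrow> vs \<noteq> [] \<Longrightarrow> length vs < m \<Longrightarrow> length ws \<le> m \<Longrightarrow>
      \<kappa> ^ length vs * cmod (\<phi> (sum_list ws + sum_list vs / of_nat m)) < prod_list (map (\<lambda>v. cmod (\<omega> v)) vs)"
    and full: "\<And>vs. set vs \<subseteq> \<Lambda>1 \<Longrightarrow> length vs = m \<Longrightarrow>
      cmod (\<phi> (sum_list vs / of_nat m)) \<le> prod_list (map (\<lambda>v. cmod (\<omega> v)) vs)"
    and full_strict: "\<And>vs. set vs \<subseteq> \<Lambda>1 \<Longrightarrow> length vs = m \<Longrightarrow> \<nexists>v. set vs \<subseteq> {v} \<Longrightarrow>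
      cmod (\<phi> (sum_list vs / of_nat m)) < prod_list (map (\<lambda>v. cmod (\<omega> v)) vs)"
    using growth unfolding growth_parameters_def by blast+
  define q where "q = growth_rate kap \<omega>"
  define c where "c i = case_sum (c0 i) d" for i
  define \<zeta> where "\<zeta> = exponent m"
  define L where "L = listset (map (\<lambda>i. K0 i <+> V) xs)"
  define C where "C ks = prod_list (map (\<lambda>(i, k). c i k) (zip xs ks))" for ks
  define Q where "Q ks = prod_list (map (\<lambda>(i, k). q i k) (zip xs ks))" for ks
  define Z where "Z ks = sum_list (map \<zeta> ks)" for ks
  define is_top where "is_top \<longleftrightarrow> length xs = m \<and> prod_list (map kap xs) = 1"
  have m: "0 < m" using xs by (cases xs) auto
  have "finite L" unfolding L_def using fin by (intro finite_listset) auto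
  have f: "f n i = (\<Sum>k\<in>K0 i <+> V. smul (c i k * q i k ^ n) (E (\<zeta> k)))" for n i
    using fin by (simp add: f_def sum.Plus c_def q_def \<zeta>_def growth_rate_def exponent_def)
  have expansion: "(T ^^ n) (nonempty_prod (map (f n) xs)) =
      (\<Sum>ks\<in>L. smul (C ks * (Q ks * \<phi> (Z ks)) ^ n) (E (Z ks)))" for n
  proof -
    have "nonempty_prod (map (f n) xs) =
        (\<Sum>ks\<in>L. smul (prod_list (map (\<lambda>(i, k). c i k * q i k ^ n) (zip xs ks))) (E (Z ks)))"
      unfolding L_def Z_def f using xs(1) by (rule nonempty_prod_expansion)
    also have "\<dots> = (\<Sum>ks\<in>L. smul (C ks * Q ks ^ n) (E (Z ks)))"
      using prod_list_mult_power[of "\<lambda>(i, k). c i k" "\<lambda>(i, k). q i k" n]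
      by (simp add: C_def Q_def split_def)
    finally show ?thesis by (simp add: T_power_sum T_power_eigenvector power_mult_distrib mult_ac)
  qed
  \<comment> \<open>The choices whose ratio is \<open>1\<close>: the same growing summand in all \<open>m\<close> factors.\<close>
  define pure where "pure ks \<longleftrightarrow> is_top \<and> (\<exists>v. ks = replicate m (Inr v))" for ks :: "(complex + complex) list"
  have contracted: "cmod (Q ks * \<phi> (Z ks)) < 1" if ks: "ks \<in> L" "\<not> pure ks" for ks
  proof -
    define ws vs where "ws = base_parts ks" and "vs = growth_parts ks"
    define P where "P = prod_list (map (\<lambda>v. cmod (\<omega> v)) vs)"
    have all2: "list_all2 (\<lambda>i k. k \<in> K0 i <+> V) xs ks" using ks(1) by (simp add: L_def in_listset_map_iff)
    have "0 \<le> \<kappa>" using kap[of undefined] by simp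
    have \<omega>0: "\<forall>v\<in>V. \<omega> v \<noteq> 0"
      using \<omega>(2) sub \<open>0 \<le> \<kappa>\<close> by force
    note parts = choice_parts[where V = V and \<omega> = \<omega> and kap = kap, OF all2 sub(1) kap \<open>0 \<le> \<kappa>\<close> \<omega>0, folded ws_def vs_def q_def \<zeta>_def,
      folded Q_def Z_def P_def]
    note ws = parts(1) and vs = parts(2) and len = parts(3) and QP = parts(5) and Q1 = parts(6)
      and pure_ks = parts(7) and Qpure = parts(8)
    have Z: "Z ks = sum_list ws + sum_list vs / of_nat m"
      using parts(4)[where m = m, folded \<zeta>_def, folded Z_def] .
    have P: "0 < P" unfolding P_def using vs \<omega>0 by (intro prod_list_pos) auto
    consider "vs = []" | "vs \<noteq> []" "length vs < m" | "length vs = m" using len xs(2) by force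
    then show ?thesis
    proof cases
      case 1
      then show ?thesis using base[of ws] ws len xs Q1 Z by (cases ws) auto
    next
      case 2
      have "cmod (Q ks) * P * cmod (\<phi> (Z ks)) \<le> \<kappa> ^ length vs * cmod (\<phi> (Z ks))"
        by (rule mult_right_mono[OF QP norm_ge_zero])
      also have "\<dots> < P" unfolding Z P_def using 2 ws vs sub len xs by (intro mixed) auto
      finally have "cmod (Q ks * \<phi> (Z ks)) * P < 1 * P" by (simp add: norm_mult mult_ac)
      then show ?thesis using P by simp
    next
      case 3
      then have lenx: "length vs = length xs" "ws = []" "length xs = m"
        using len xs(2) by (simp_all flip: length_0_conv)
      have "cmod (Q ks) * P = prod_list (map kap xs)"
        using arg_cong[OF Qpure[OF lenx(1)], of cmod] prod_list_pos[of xs kap] kap(1)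
        by (simp add: norm_mult norm_prod_list P_def)
      moreover have "prod_list (map kap xs) * cmod (\<phi> (Z ks)) < P"
      proof (cases "\<exists>v. set vs \<subseteq> {v}")
        case True
        then obtain v where "set vs \<subseteq> {v}" by blast
        then have "vs = replicate m v" using 3 by (metis replicate_eqI singletonD subsetD)
        then have "ks = replicate m (Inr v)" using pure_ks lenx by simp
        then have "prod_list (map kap xs) < 1"
          using ks(2) kap_top[OF lenx(3)] lenx(3) unfolding pure_def is_top_def by force
        moreover have "cmod (\<phi> (Z ks)) \<le> P"
          using full[of vs] vs sub 3 by (simp add: Z lenx P_def)
        moreover have "0 < prod_list (map kap xs)" using kap by (intro prod_list_pos) auto
        ultimately have "prod_list (map kap xs) * cmod (\<phi> (Z ks)) \<le> prod_list (map kap xs) * P"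
          and "prod_list (map kap xs) * P < 1 * P"
          using P by (auto intro!: mult_left_mono mult_strict_right_mono)
        then show ?thesis by simp
      next
        case False
        have "prod_list (map kap xs) * cmod (\<phi> (Z ks)) \<le> 1 * cmod (\<phi> (Z ks))"
          using kap_top lenx by (intro mult_right_mono) auto
        also have "\<dots> < P"
          using full_strict[of vs] vs sub 3 False by (simp add: Z lenx P_def)
        finally show ?thesis .
      qed
      moreover have "cmod (Q ks * \<phi> (Z ks)) * P = cmod (Q ks) * P * cmod (\<phi> (Z ks))"
        by (simp add: norm_mult)
      ultimately have "cmod (Q ks * \<phi> (Z ks)) * P < 1 * P" by simp
      then show ?thesis using P by simp
    qed
  qed
  define R :: "(complex + complex) list set" where "R = (\<lambda>v. replicate m (Inr v)) ` V"
  have pure_term: "smul (C ks * (Q ks * \<phi> (Z ks)) ^ n) (E (Z ks)) = smul (d v ^ m) (E v)"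
    if top: "is_top" and v: "v \<in> V" "ks = replicate m (Inr v)" for ks v n
  proof -
    have lenx: "length xs = m" and kap1: "prod_list (map kap xs) = 1" using top by (simp_all add: is_top_def)
    have "\<omega> v \<noteq> 0" using \<omega>(2)[of v] v sub kap[of undefined] by auto
    have zip: "zip xs ks = map (\<lambda>i. (i, Inr v)) xs"
      using lenx unfolding v(2) by (simp add: zip_replicate2)
    have "C ks = d v ^ length xs" unfolding C_def zip c_def by (induction xs) simp_all
    then have "C ks = d v ^ m" using lenx by simp
    moreover have "Z ks = v" using m unfolding Z_def v(2) \<zeta>_def exponent_def by (simp add: sum_list_replicate)
    moreover have "Q ks * \<omega> v ^ length xs = of_real (prod_list (map kap xs))"
      using \<open>\<omega> v \<noteq> 0\<close> unfolding Q_def zip q_def growth_rate_def by (induction xs) simp_all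
    then have "Q ks * \<phi> v = 1" using \<omega>(1)[of v] v sub lenx kap1 by auto
    ultimately show ?thesis by simp
  qed
  have "(\<lambda>n. \<Sum>ks\<in>L. smul (C ks * (Q ks * \<phi> (Z ks)) ^ n) (E (Z ks))) \<longlonglongrightarrow>
      (\<Sum>ks\<in>L. if pure ks then smul (C ks * (Q ks * \<phi> (Z ks)) ^ 0) (E (Z ks)) else 0)"
  proof (rule tendsto_sum)
    fix ks assume ks: "ks \<in> L"
    show "(\<lambda>n. smul (C ks * (Q ks * \<phi> (Z ks)) ^ n) (E (Z ks))) \<longlonglongrightarrow>
      (if pure ks then smul (C ks * (Q ks * \<phi> (Z ks)) ^ 0) (E (Z ks)) else 0)"
    proof (cases "pure ks")
      case True
      then obtain v where v: "is_top" "ks = replicate m (Inr v)" by (auto simp: pure_def)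
      then have "Inr v \<in> set ks" using m by simp
      then have "v \<in> V" using ks growth_choice_in[of K0 V xs ks v] unfolding L_def in_listset_map_iff by blast
      then show ?thesis using True pure_term v by (simp only: if_True) simp
    next
      case False
      then show ?thesis using tendsto_zero_of_contracted_eigenvector contracted ks by simp
    qed
  qed
  also have "(\<Sum>ks\<in>L. if pure ks then smul (C ks * (Q ks * \<phi> (Z ks)) ^ 0) (E (Z ks)) else 0) =
      (if is_top then \<Sum>v\<in>V. smul (d v ^ m) (E v) else 0)"
  proof (cases is_top)
    case True
    have "L \<inter> {ks. pure ks} = R"
    proof (intro equalityI subsetI)
      fix ks assume "ks \<in> L \<inter> {ks. pure ks}"
      then obtain v where ks: "ks \<in> L" "ks = replicate m (Inr v)" by (auto simp: pure_def)
      then have "Inr v \<in> set ks" using m by simp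
      then have "v \<in> V" using ks growth_choice_in[of K0 V xs ks v] unfolding L_def in_listset_map_iff by blast
      then show "ks \<in> R" using ks by (auto simp: R_def)
    next
      fix ks assume "ks \<in> R"
      then show "ks \<in> L \<inter> {ks. pure ks}"
        using True by (auto simp: R_def L_def in_listset_map_iff pure_def is_top_def list_all2_conv_all_nth)
    qed
    then have "(\<Sum>ks\<in>L. if pure ks then smul (C ks * (Q ks * \<phi> (Z ks)) ^ 0) (E (Z ks)) else 0) =
        (\<Sum>ks\<in>R. smul (C ks * (Q ks * \<phi> (Z ks)) ^ 0) (E (Z ks)))"
      using \<open>finite L\<close> by (simp add: sum.If_cases)
    also have "\<dots> = (\<Sum>v\<in>V. smul (d v ^ m) (E v))"
      unfolding R_def
    proof (subst sum.reindex)
      show "inj_on (\<lambda>v. replicate m (Inr v)) V" using m by (simp add: inj_on_def)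
    qed (use pure_term[OF True _ refl, of _ 0] in simp)
    finally show ?thesis using True by simp
  qed (simp add: pure_def)
  finally show ?thesis by (simp add: expansion is_top_def)
qed

end

section \<open>Sequence spaces and genericity\<close>

lemma tendsto_pointwise_product:
  fixes f :: "'n \<Rightarrow> 'i \<Rightarrow> 'b::topological_space"
  assumes "\<And>i. ((\<lambda>n. f n i) \<longlongrightarrow> l i) F"
  shows "(f \<longlongrightarrow> l) F"
proof -
  have "limitin (product_topology (\<lambda>i. euclidean) UNIV) f l F"
    unfolding limitin_componentwise using assms by simp
  then show ?thesis unfolding euclidean_product_topology by simp
qed

lemma generically_if_countable_open_dense:
  fixes \<G> :: "'b::complete_space set set"
  assumes "countable \<G>" "\<And>G. G \<in> \<G> \<Longrightarrow> open G" "\<And>G. G \<in> \<G> \<Longrightarrow> closure G = UNIV"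
    and "\<And>x. x \<in> \<Inter>\<G> \<Longrightarrow> Q x"
  shows "generically Q"
  unfolding generically_def
proof (intro exI conjI)
  have "(euclidean :: 'b topology) closure_of \<Inter>\<G> = topspace euclidean"
    using assms(1-3)
    by (intro Baire_category disjI1 completely_metrizable_space_euclidean) (simp_all add: open_openin[symmetric])
  then show "closure (\<Inter>\<G>) = UNIV" by simp
  show "gdelta (\<Inter>\<G>)"
  proof -
    define F where "F = from_nat_into (insert UNIV \<G>)"
    have F: "range F = insert UNIV \<G>" using assms(1) by (simp add: F_def)
    have "open (F n)" for n
    proof -
      have "F n \<in> insert UNIV \<G>" unfolding F[symmetric] by (rule rangeI)
      then show ?thesis using assms(2) by (metis insertE open_UNIV)
    qed
    moreover have "\<Inter>(range F) = \<Inter>\<G>" unfolding F by simp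
    ultimately show ?thesis using gdelta.intros[of F] by simp
  qed
  show "\<forall>x\<in>\<Inter>\<G>. Q x" using assms(4) by blast
qed

lemma closure_UNIV_dist:
  fixes S :: "'b::metric_space set"
  shows "closure S = UNIV \<longleftrightarrow> (\<forall>x e. 0 < e \<longrightarrow> (\<exists>y\<in>S. dist y x < e))"
  unfolding set_eq_iff closure_approachable by blast

section \<open>The leading monomial\<close>

text \<open>
  A monomial is represented by the list of the indices of its factors. If \<open>\<alpha>\<close> and \<open>\<beta>\<close> are the exponent vectors of
  \<open>xs\<close> and \<open>ys\<close>, then \<open>overlap ys xs\<close> is their inner product.
\<close>

definition overlap :: "'i list \<Rightarrow> 'i list \<Rightarrow> nat" where
  "overlap ys xs = sum_list (map (count_list ys) xs)"

definition dominated :: "'i list \<Rightarrow> 'i list \<Rightarrow> bool" where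
  "dominated ys xs \<longleftrightarrow>
     length xs < length ys \<or> length xs = length ys \<and> overlap ys xs < overlap ys ys"

text \<open>
  Among the monomials of maximal degree choose the one whose exponent vector \<open>\<beta>\<close> is longest. For any other vector
  \<open>\<alpha>\<close> of the same degree \<open>\<bar>\<alpha> - \<beta>\<bar>\<^sup>2 > 0\<close> and \<open>\<bar>\<alpha>\<bar> \<le> \<bar>\<beta>\<bar>\<close> give \<open>\<alpha> \<bullet> \<beta> < \<beta> \<bullet> \<beta>\<close>, so \<open>\<beta>\<close> itself serves as the
  linear functional that separates the leading monomial from the others. The choice depends on the exponents only,
  so it is the same for all polynomials with the same support.
\<close>

lemma exists_dominating_list:
  assumes fin: "finite L" and ne: "L \<noteq> {}" and inj: "inj_on count_list L"
  obtains ys where "ys \<in> L" "\<And>xs. xs \<in> L - {ys} \<Longrightarrow> dominated ys xs"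
proof -
  define M where "M = Max (length ` L)"
  define L' where "L' = {xs \<in> L. length xs = M}"
  have M: "length xs \<le> M" if "xs \<in> L" for xs using that fin by (simp add: M_def)
  have "M \<in> length ` L" unfolding M_def using fin ne by (intro Max_in) auto
  then have L': "finite L'" "L' \<noteq> {}" using fin by (auto simp: L'_def)
  have "Max ((\<lambda>xs. overlap xs xs) ` L') \<in> (\<lambda>xs. overlap xs xs) ` L'"
    using L' by (intro Max_in) auto
  then obtain ys where ys: "ys \<in> L'" "overlap ys ys = Max ((\<lambda>xs. overlap xs xs) ` L')" by force
  have max: "overlap xs xs \<le> overlap ys ys" if "xs \<in> L'" for xs
    using that L' by (simp add: ys(2))
  show ?thesis
  proof (rule that[of ys])
    show "ys \<in> L" using ys by (simp add: L'_def)
    fix xs assume xs: "xs \<in> L - {ys}"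
    show "dominated ys xs"
    proof (cases "length xs = M")
      case False
      then show ?thesis using M[of xs] xs ys by (auto simp: dominated_def L'_def)
    next
      case True
      define X where "X = set xs \<union> set ys"
      have overlap: "real (overlap as bs) = (\<Sum>x\<in>X. real (count_list bs x) * real (count_list as x))"
        if "set bs \<subseteq> X" for as bs
        unfolding overlap_def using sum_list_map_eq_sum_count2[OF that, of "count_list as"] by (simp add: X_def)
      have "count_list xs \<noteq> count_list ys" using inj xs ys by (auto simp: inj_on_def L'_def)
      then obtain x where x: "count_list xs x \<noteq> count_list ys x" by blast
      have "x \<in> X"
      proof (rule ccontr)
        assume "x \<notin> X"
        then have "count_list xs x = 0" "count_list ys x = 0" by (simp_all add: X_def)
        with x show False by simp
      qed
      then have "0 < (\<Sum>x\<in>X. (real (count_list xs x) - real (count_list ys x))\<^sup>2)"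
        using x by (intro sum_pos2[of _ x]) (auto simp: X_def)
      also have "\<dots> = real (overlap xs xs) + real (overlap ys ys) - 2 * real (overlap ys xs)"
        by (simp add: overlap X_def power2_eq_square algebra_simps sum.distrib sum_subtractf sum_distrib_left)
      finally have "2 * overlap ys xs < overlap xs xs + overlap ys ys" by linarith
      moreover have "overlap xs xs \<le> overlap ys ys" using xs True by (intro max) (simp add: L'_def)
      ultimately show ?thesis using True ys by (simp add: dominated_def L'_def)
    qed
  qed
qed

text \<open>
  The weights are exponentials of the functional \<open>\<alpha> \<mapsto> \<alpha> \<bullet> \<beta>\<close>, shifted so that the leading monomial gets weight \<open>1\<close>
  and scaled so that no single weight exceeds \<open>\<kappa>\<close>.
\<close>

lemma separating_weights:
  fixes \<kappa> :: real
  assumes "1 < \<kappa>" and "ys \<noteq> []"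
  obtains kap :: "'i \<Rightarrow> real" where "\<And>i. 0 < kap i" "\<And>i. kap i \<le> \<kappa>" "prod_list (map kap ys) = 1"
    "\<And>xs. length xs = length ys \<Longrightarrow> overlap ys xs < overlap ys ys \<Longrightarrow> prod_list (map kap xs) < 1"
proof -
  define m where "m = real (length ys)"
  define N where "N = real (overlap ys ys)"
  define kap where "kap i = \<kappa> powr ((real (count_list ys i) - N / m) / m)" for i
  have m: "0 < m" using assms(2) by (simp add: m_def)
  have prod: "prod_list (map kap xs) = \<kappa> powr ((real (overlap ys xs) - length xs * (N / m)) / m)" for xs
  proof (induction xs)
    case (Cons x xs)
    then show ?case
      by (simp add: kap_def overlap_def diff_divide_distrib add_divide_distrib algebra_simps flip: powr_add)
  qed (use assms in \<open>simp add: overlap_def\<close>)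
  show ?thesis
  proof (rule that[of kap])
    show "0 < kap i" for i using assms by (simp add: kap_def)
    show "kap i \<le> \<kappa>" for i
    proof -
      have "real (count_list ys i) \<le> m" by (simp add: m_def count_le_length)
      moreover have "0 \<le> N / m" using m by (simp add: N_def)
      ultimately have "real (count_list ys i) - N / m \<le> m" by linarith
      then have "(real (count_list ys i) - N / m) / m \<le> 1" using m by (simp add: divide_le_eq)
      from powr_mono[OF this, of \<kappa>] show ?thesis using assms by (simp add: kap_def)
    qed
    show "prod_list (map kap ys) = 1" using m assms by (simp add: prod flip: m_def N_def)
    fix xs assume xs: "length xs = length ys" "overlap ys xs < overlap ys ys"
    then have "(real (overlap ys xs) - length xs * (N / m)) / m < 0"
      using m by (simp add: divide_less_0_iff N_def flip: m_def)
    then show "prod_list (map kap xs) < 1" unfolding prod using assms by (simp add: powr_less_one)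
  qed
qed

section \<open>Steering the orbits of polynomials\<close>

locale hypercyclic_algebra_setting = exponential_eigenvectors smul T E \<phi>
  for smul :: "complex \<Rightarrow> 'a \<Rightarrow>
    'a::{comm_ring, topological_ab_group_add, topological_semigroup_mult, complete_space}"
    and T :: "'a \<Rightarrow> 'a" and E :: "complex \<Rightarrow> 'a" and \<phi> :: "complex \<Rightarrow> complex" +
  fixes \<theta> r R :: real
  assumes separable: "separable_space (euclidean :: 'a topology)"
    and nontrivial: "\<exists>x::'a. x \<noteq> 0"
    and entire: "\<phi> holomorphic_on UNIV"
    and phi_0: "cmod (\<phi> 0) = 1"
    and total: "z islimpt \<Lambda> \<Longrightarrow> closure (span (E ` \<Lambda>)) = UNIV"
    and rR: "0 < r" "0 < R"
    and small: "0 < t \<Longrightarrow> t < r \<Longrightarrow> cmod (\<phi> (of_real t * cis \<theta>)) < 1"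
    and large: "1 < cmod (\<phi> (of_real R * cis \<theta>))"
begin

lemma span_eigenvectorsE:
  assumes "x \<in> span (E ` \<Lambda>)"
  obtains K c where "finite K" "K \<subseteq> \<Lambda>" "x = (\<Sum>l\<in>K. smul (c l) (E l))"
proof -
  obtain t c where t: "finite t" "t \<subseteq> E ` \<Lambda>" "x = (\<Sum>a\<in>t. smul (c a) a)"
    using assms unfolding span_explicit by blast
  then obtain K where K: "K \<subseteq> \<Lambda>" "inj_on E K" "t = E ` K"
    unfolding subset_image_inj by blast
  show ?thesis
  proof (rule that[of K "c \<circ> E"])
    show "finite K" using t(1) K(2,3) by (simp add: finite_image_iff)
    show "x = (\<Sum>l\<in>K. smul ((c \<circ> E) l) (E l))" unfolding t(3) K(3) by (simp add: sum.reindex[OF K(2)])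
  qed (rule K(1))
qed

text \<open>
  The transitivity step. Approximate a point of \<open>U\<close> by combinations of eigenvectors over \<open>\<Lambda>0\<close> and the target \<open>y\<close> by
  a combination over \<open>\<Lambda>1\<close> with coefficients \<open>b v = d v ^ m\<close>. Adding to the \<open>i\<close>-th coordinate the summands
  \<open>d v * (kap i / \<omega> v) ^ n * E (v / m)\<close>, which tend to \<open>0\<close>, changes the point arbitrarily little, while \<open>T ^^ n\<close>
  sends the leading monomial towards \<open>y\<close> and the dominated ones towards \<open>0\<close>.
\<close>

lemma monomials_reach_target:
  assumes ys: "ys \<noteq> []" and fin: "finite Ls"
    and dom: "\<And>xs. xs \<in> Ls \<Longrightarrow> xs \<noteq> [] \<and> dominated ys xs"
    and U: "open U" "U \<noteq> {}" and e: "0 < e"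
  shows "\<exists>f\<in>U. \<exists>n. dist ((T ^^ n) (nonempty_prod (map f ys))) y < e \<and>
    (\<forall>xs\<in>Ls. dist ((T ^^ n) (nonempty_prod (map f xs))) 0 < e)"
proof -
  define m where "m = length ys"
  have m: "0 < m" using ys by (simp add: m_def)
  obtain \<kappa> \<Lambda>0 \<Lambda>1 a0 a1 \<omega> where \<kappa>: "1 < \<kappa>" and lim: "a0 islimpt \<Lambda>0" "a1 islimpt \<Lambda>1"
    and growth: "growth_parameters \<phi> m \<kappa> \<Lambda>0 \<Lambda>1 \<omega>"
    by (rule growth_parameters_exist[OF entire phi_0 rR small large m])
  have \<omega>: "\<kappa> < cmod (\<omega> v)" if "v \<in> \<Lambda>1" for v
    using growth that unfolding growth_parameters_def by blast
  obtain kap where kap: "\<And>i. 0 < kap i" "\<And>i. kap i \<le> \<kappa>" "prod_list (map kap ys) = 1"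
    "\<And>xs. length xs = length ys \<Longrightarrow> overlap ys xs < overlap ys ys \<Longrightarrow> prod_list (map kap xs) < 1"
    by (rule separating_weights[OF \<kappa> ys]) blast
  obtain u where u: "u \<in> U" "\<And>i. u i \<in> span (E ` \<Lambda>0)"
  proof -
    obtain x where "x \<in> U" using U by blast
    moreover have "openin (product_topology (\<lambda>i. euclidean) UNIV) U"
      using U(1) by (simp add: open_fun_def)
    ultimately obtain X where X: "x \<in> Pi\<^sub>E UNIV X" "\<And>i. open (X i)" "Pi\<^sub>E UNIV X \<subseteq> U"
      using product_topology_open_contains_basis[of "\<lambda>i. euclidean" UNIV U x] by auto
    have "\<exists>v. v \<in> X i \<and> v \<in> span (E ` \<Lambda>0)" for i
      using total[OF lim(1)] open_Int_closure_eq_empty[OF X(2), of i "span (E ` \<Lambda>0)"] X(1) by auto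
    then obtain u where "\<And>i. u i \<in> X i \<and> u i \<in> span (E ` \<Lambda>0)" by metis
    then show thesis using X(3) by (intro that[of u]) auto
  qed
  have "\<exists>K c. finite K \<and> K \<subseteq> \<Lambda>0 \<and> u i = (\<Sum>l\<in>K. smul (c l) (E l))" for i
    by (rule span_eigenvectorsE[OF u(2)]) blast
  then obtain K0 c0 where K0: "\<And>i. finite (K0 i)" "\<And>i. K0 i \<subseteq> \<Lambda>0"
      "\<And>i. u i = (\<Sum>l\<in>K0 i. smul (c0 i l) (E l))"
    by metis
  obtain y' where y': "y' \<in> span (E ` \<Lambda>1)" "dist y' y < e"
    using total[OF lim(2)] e by (meson closure_UNIV_dist)
  obtain V b where V: "finite V" "V \<subseteq> \<Lambda>1" "y' = (\<Sum>v\<in>V. smul (b v) (E v))"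
    by (rule span_eigenvectorsE[OF y'(1)])
  have "\<exists>d. d ^ m = b v" for v
    by (rule exists_complex_root[of m "b v"]) (use m in auto)
  then obtain d where d: "\<And>v. d v ^ m = b v" by metis
  define f where "f n i = (\<Sum>l\<in>K0 i. smul (c0 i l) (E l)) +
      (\<Sum>v\<in>V. smul (d v * (of_real (kap i) / \<omega> v) ^ n) (E (v / of_nat m)))" for n i
  have "f \<longlonglongrightarrow> u"
  proof (rule tendsto_pointwise_product)
    fix i
    have "(\<lambda>n. smul (d v * (of_real (kap i) / \<omega> v) ^ n) (E (v / of_nat m))) \<longlonglongrightarrow> 0" if "v \<in> V" for v
    proof (rule tendsto_zero_of_contracted_eigenvector)
      have "cmod (\<omega> v) > kap i" using \<omega>[of v] kap(2)[of i] that V by force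
      then show "cmod (of_real (kap i) / \<omega> v) < 1" using kap(1)[of i] by (simp add: norm_divide divide_less_eq)
    qed
    then have "(\<lambda>n. u i + (\<Sum>v\<in>V. smul (d v * (of_real (kap i) / \<omega> v) ^ n) (E (v / of_nat m))))
        \<longlonglongrightarrow> u i + (\<Sum>v\<in>V. 0)"
      by (intro tendsto_intros)
    then show "(\<lambda>n. f n i) \<longlonglongrightarrow> u i" by (simp add: f_def K0(3))
  qed
  then have inU: "eventually (\<lambda>n. f n \<in> U) sequentially" using U(1) u(1) by (rule topological_tendstoD)
  have orbit: "(\<lambda>n. (T ^^ n) (nonempty_prod (map (f n) xs))) \<longlonglongrightarrow>
      (if length xs = m \<and> prod_list (map kap xs) = 1 then \<Sum>v\<in>V. smul (d v ^ m) (E v) else 0)"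
    if "xs \<noteq> []" "length xs \<le> m" "length xs = m \<Longrightarrow> prod_list (map kap xs) \<le> 1" for xs
    unfolding f_def
    by (rule monomial_orbit_limit[where ?\<Lambda>0.0 = \<Lambda>0 and ?\<Lambda>1.0 = \<Lambda>1 and \<kappa> = \<kappa> and \<omega> = \<omega>
        and kap = kap and ?K0.0 = K0 and V = V and ?c0.0 = c0 and d = d and m = m and xs = xs, OF that(1,2) K0(1) V(1) K0(2) V(2) kap(1,2) that(3) growth])
  have "(\<lambda>n. (T ^^ n) (nonempty_prod (map (f n) ys))) \<longlonglongrightarrow> y'"
    using orbit[of ys] ys kap(3) by (simp add: m_def V(3) d flip: m_def)
  then have near_y: "eventually (\<lambda>n. dist ((T ^^ n) (nonempty_prod (map (f n) ys))) y < e) sequentially"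
    using y'(2) by (intro order_tendstoD(2)[OF tendsto_dist[OF _ tendsto_const]])
  have near_0: "eventually (\<lambda>n. dist ((T ^^ n) (nonempty_prod (map (f n) xs))) 0 < e) sequentially"
    if "xs \<in> Ls" for xs
  proof -
    have xs: "xs \<noteq> []" "length xs \<le> m" "length xs = m \<Longrightarrow> prod_list (map kap xs) < 1"
      using dom[OF that] kap(4)[of xs] by (auto simp: dominated_def m_def)
    then have "(\<lambda>n. (T ^^ n) (nonempty_prod (map (f n) xs))) \<longlonglongrightarrow> 0"
      using orbit[of xs] by (cases "length xs = m") auto
    then show ?thesis using e by (rule tendstoD)
  qed
  have "eventually (\<lambda>n. f n \<in> U \<and> dist ((T ^^ n) (nonempty_prod (map (f n) ys))) y < e \<and>
      (\<forall>xs\<in>Ls. dist ((T ^^ n) (nonempty_prod (map (f n) xs))) 0 < e)) sequentially"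
    using near_0 by (intro eventually_conj inU near_y eventually_ball_finite fin) auto
  then show ?thesis using eventually_happens'[OF sequentially_bot] by blast
qed

end

lemma continuous_nonempty_prod:
  fixes xs :: "'i list"
  shows "continuous_on UNIV (\<lambda>f :: 'i \<Rightarrow> 'a::{comm_ring, topological_semigroup_mult}. nonempty_prod (map f xs))"
proof (induction xs)
  case (Cons x xs)
  then show ?case
    by (cases xs) (simp_all add: continuous_on_mult')
qed simp

section \<open>Polynomials as combinations of monomials\<close>

text \<open>
  The map \<open>\<nu>\<close> sends the variables of a polynomial to the coordinates of a sequence that are substituted for them.
\<close>

definition monomial_indices :: "(nat \<Rightarrow> 'i) \<Rightarrow> (nat \<Rightarrow>\<^sub>0 nat) \<Rightarrow> 'i list" where
  "monomial_indices \<nu> \<alpha> = map \<nu> (concat (map (\<lambda>i. replicate (Poly_Mapping.lookup \<alpha> i) i)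
     (sorted_list_of_set (Poly_Mapping.keys \<alpha>))))"

lemma eval_monomial_conv:
  assumes "Poly_Mapping.keys \<alpha> \<subseteq> {..<k}" "\<And>i. i < k \<Longrightarrow> g i = f (\<nu> i)"
  shows "eval_monomial g \<alpha> = nonempty_prod (map f (monomial_indices \<nu> \<alpha>))"
proof -
  have "concat (map (\<lambda>i. replicate (Poly_Mapping.lookup \<alpha> i) (g i)) (sorted_list_of_set (Poly_Mapping.keys \<alpha>))) =
    concat (map (\<lambda>i. replicate (Poly_Mapping.lookup \<alpha> i) (f (\<nu> i))) (sorted_list_of_set (Poly_Mapping.keys \<alpha>)))"
    using assms by (intro arg_cong[where f = concat] map_cong) auto
  then show ?thesis by (simp add: eval_monomial_def monomial_indices_def map_concat o_def)
qed

lemma count_list_concat: "count_list (concat xss) x = sum_list (map (\<lambda>xs. count_list xs x) xss)"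
  by (induction xss) simp_all

lemma count_list_replicate: "count_list (replicate n y) x = (if x = y then n else 0)"
  by (induction n) auto

lemma count_monomial_indices:
  assumes \<alpha>: "Poly_Mapping.keys \<alpha> \<subseteq> {..<k}" and \<nu>: "inj_on \<nu> {..<k}" and i: "i < k"
  shows "count_list (monomial_indices \<nu> \<alpha>) (\<nu> i) = Poly_Mapping.lookup \<alpha> i"
proof -
  let ?K = "Poly_Mapping.keys \<alpha>"
  have "count_list (monomial_indices \<nu> \<alpha>) (\<nu> i) = (\<Sum>j\<in>?K. if \<nu> i = \<nu> j then Poly_Mapping.lookup \<alpha> j else 0)"
    by (simp add: monomial_indices_def map_concat count_list_concat o_def count_list_replicate
        sum_list_distinct_conv_sum_set)
  also have "\<dots> = (\<Sum>j\<in>?K. if j = i then Poly_Mapping.lookup \<alpha> j else 0)"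
    using \<alpha> i by (intro sum.cong refl) (auto dest: inj_onD[OF \<nu>])
  also have "\<dots> = Poly_Mapping.lookup \<alpha> i" by (simp add: in_keys_iff)
  finally show ?thesis .
qed

lemma exponent_eqI_count:
  assumes \<alpha>: "Poly_Mapping.keys \<alpha> \<subseteq> {..<k}" "Poly_Mapping.keys \<beta> \<subseteq> {..<k}" and \<nu>: "inj_on \<nu> {..<k}"
    and eq: "count_list (monomial_indices \<nu> \<alpha>) = count_list (monomial_indices \<nu> \<beta>)"
  shows "\<alpha> = \<beta>"
proof (rule poly_mapping_eqI)
  fix i
  show "Poly_Mapping.lookup \<alpha> i = Poly_Mapping.lookup \<beta> i"
  proof (cases "i < k")
    case True
    then show ?thesis using count_monomial_indices[OF _ \<nu> True] \<alpha> eq by metis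
  next
    case False
    then have "i \<notin> Poly_Mapping.keys \<alpha>" "i \<notin> Poly_Mapping.keys \<beta>" using \<alpha> by auto
    then show ?thesis by (simp add: in_keys_iff)
  qed
qed

context hypercyclic_algebra_setting
begin

section \<open>The generic sequence\<close>

text \<open>
  At tolerance \<open>1 / (k + 1)\<close>, some iterate takes the monomial \<open>ys\<close> to \<open>y\<close> and all monomials in \<open>Ls\<close> to \<open>0\<close>.
\<close>

definition steering_set :: "nat list set \<Rightarrow> nat list \<Rightarrow> 'a \<Rightarrow> nat \<Rightarrow> (nat \<Rightarrow> 'a) set" where
  "steering_set Ls ys y k = {f. \<exists>n. dist ((T ^^ n) (nonempty_prod (map f ys))) y < inverse (Suc k) \<and>
     (\<forall>xs\<in>Ls. dist ((T ^^ n) (nonempty_prod (map f xs))) 0 < inverse (Suc k))}"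

definition admissible :: "nat list set \<times> nat list \<Rightarrow> bool" where
  "admissible = (\<lambda>(Ls, ys). finite Ls \<and> ys \<noteq> [] \<and> (\<forall>xs\<in>Ls. xs \<noteq> [] \<and> dominated ys xs))"

lemma open_steering_set:
  assumes "finite Ls"
  shows "open (steering_set Ls ys y k)"
proof -
  have cont: "continuous_on UNIV (\<lambda>f. dist ((T ^^ n) (nonempty_prod (map f xs))) z)" for n xs z
    by (intro continuous_on_dist continuous_on_const
        continuous_on_compose2[OF continuous_T_power continuous_nonempty_prod]) auto
  have "steering_set Ls ys y k =
    (\<Union>n. {f. dist ((T ^^ n) (nonempty_prod (map f ys))) y < inverse (Suc k)} \<inter>
      (\<Inter>xs\<in>Ls. {f. dist ((T ^^ n) (nonempty_prod (map f xs))) 0 < inverse (Suc k)}))"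
    by (auto simp: steering_set_def)
  also have "open \<dots>"
    by (intro open_UN open_Int open_INT ballI assms open_Collect_less cont continuous_on_const)
  finally show ?thesis .
qed

lemma dense_steering_set:
  assumes "admissible (Ls, ys)"
  shows "closure (steering_set Ls ys y k) = UNIV"
proof -
  let ?S = "steering_set Ls ys y k"
  have meets: "?S \<inter> U \<noteq> {}" if "open U" "U \<noteq> {}" for U
    using monomials_reach_target[of ys Ls U "inverse (Suc k)" y] assms that
    by (fastforce simp: admissible_def steering_set_def)
  show ?thesis
  proof (rule ccontr)
    assume "closure ?S \<noteq> UNIV"
    then have "?S \<inter> - closure ?S \<noteq> {}" by (intro meets) auto
    then show False using closure_subset by blast
  qed
qed

text \<open>
  Basic open sets of the product restrict finitely many coordinates, so a late coordinate can be set to \<open>y\<close>.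
\<close>

lemma dense_hitting_set: "closure {f :: nat \<Rightarrow> 'a. \<exists>i. dist (f i) y < inverse (Suc k)} = UNIV"
proof -
  have "u \<in> closure {f :: nat \<Rightarrow> 'a. \<exists>i. dist (f i) y < inverse (Suc k)}" for u
  proof (rule Lim_in_closed_set[OF closed_closure _ sequentially_bot])
    show "(\<lambda>n. u(n := y)) \<longlonglongrightarrow> u"
    proof (rule tendsto_pointwise_product)
      fix i
      have "eventually (\<lambda>n. (u(n := y)) i = u i) sequentially"
        using eventually_gt_at_top[of i] by eventually_elim simp
      then show "(\<lambda>n. (u(n := y)) i) \<longlonglongrightarrow> u i" by (rule tendsto_eventually)
    qed
    have "u(n := y) \<in> {f. \<exists>i. dist (f i) y < inverse (Suc k)}" for n
      by (auto intro!: exI[of _ n])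
    then show "eventually (\<lambda>n. u(n := y) \<in> closure {f. \<exists>i. dist (f i) y < inverse (Suc k)}) sequentially"
      using closure_subset by (intro always_eventually) blast
  qed
  then show ?thesis by blast
qed

text \<open>
  To approach \<open>y\<close>, steer the leading monomial to \<open>y / c ys\<close> and the others to \<open>0\<close>. The coefficients enter only
  here, so countably many conditions on \<open>f\<close> handle uncountably many polynomials.
\<close>

lemma hypercyclic_combination:
  assumes D: "closure D = UNIV" and fin: "finite L" and ys: "ys \<in> L" and cy: "c ys \<noteq> 0"
    and steer: "\<And>y k. y \<in> D \<Longrightarrow> f \<in> steering_set (L - {ys}) ys y k"
  shows "hypercyclic T (\<Sum>xs\<in>L. smul (c xs) (nonempty_prod (map f xs)))" (is "hypercyclic T ?x")
proof -
  have "y \<in> closure (range (\<lambda>n. (T ^^ n) ?x))" for y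
  proof -
    define z where "z = smul (inverse (c ys)) y"
    have "\<exists>d\<in>D. dist d z < inverse (Suc k)" for k using D by (simp add: closure_UNIV_dist)
    then obtain d where d: "\<And>k. d k \<in> D" "\<And>k. dist (d k) z < inverse (Suc k)" by metis
    have "\<exists>n. dist ((T ^^ n) (nonempty_prod (map f ys))) (d k) < inverse (Suc k) \<and>
        (\<forall>xs\<in>L - {ys}. dist ((T ^^ n) (nonempty_prod (map f xs))) 0 < inverse (Suc k))" for k
      using steer[OF d(1), of k k] by (simp only: steering_set_def mem_Collect_eq)
    then obtain n where "\<And>k. dist ((T ^^ n k) (nonempty_prod (map f ys))) (d k) < inverse (Suc k) \<and>
        (\<forall>xs\<in>L - {ys}. dist ((T ^^ n k) (nonempty_prod (map f xs))) 0 < inverse (Suc k))" by metis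
    then have n: "\<And>k. dist ((T ^^ n k) (nonempty_prod (map f ys))) (d k) < inverse (Suc k)"
      "\<And>k xs. xs \<in> L - {ys} \<Longrightarrow> dist ((T ^^ n k) (nonempty_prod (map f xs))) 0 < inverse (Suc k)"
      by blast+
    have lim0: "(\<lambda>k. inverse (real (Suc k))) \<longlonglongrightarrow> 0" by (rule LIMSEQ_inverse_real_of_nat)
    have "(\<lambda>k. (T ^^ n k) (nonempty_prod (map f ys))) \<longlonglongrightarrow> z"
    proof (rule metric_tendsto_imp_tendsto[OF _ always_eventually])
      show "(\<lambda>k. inverse (real (Suc k)) + inverse (real (Suc k))) \<longlonglongrightarrow> 0"
        using tendsto_add[OF lim0 lim0] by simp
      show "\<forall>k. dist ((T ^^ n k) (nonempty_prod (map f ys))) z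
          \<le> dist (inverse (real (Suc k)) + inverse (real (Suc k))) 0"
        using n(1) d(2) dist_triangle[of "(T ^^ n k) (nonempty_prod (map f ys))" z "d k" for k]
        by (smt (verit) dist_real_def)
    qed
    moreover have "(\<lambda>k. (T ^^ n k) (nonempty_prod (map f xs))) \<longlonglongrightarrow> 0" if "xs \<in> L - {ys}" for xs
      using n(2)[OF that] by (intro metric_tendsto_imp_tendsto[OF lim0 always_eventually]) (auto intro: less_imp_le)
    ultimately have "(\<lambda>k. smul (c xs) ((T ^^ n k) (nonempty_prod (map f xs)))) \<longlonglongrightarrow>
        smul (c xs) (if xs = ys then z else 0)" if "xs \<in> L" for xs
      using that by (intro tendsto_smul tendsto_const) auto
    then have "(\<lambda>k. \<Sum>xs\<in>L. smul (c xs) ((T ^^ n k) (nonempty_prod (map f xs)))) \<longlonglongrightarrow>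
        (\<Sum>xs\<in>L. smul (c xs) (if xs = ys then z else 0))"
      by (rule tendsto_sum)
    also have "(\<Sum>xs\<in>L. smul (c xs) (if xs = ys then z else 0)) = (\<Sum>xs\<in>L. if xs = ys then y else 0)"
      using cy by (intro sum.cong) (auto simp: z_def)
    also have "\<dots> = y" using fin ys by simp
    finally have "(\<lambda>k. (T ^^ n k) ?x) \<longlonglongrightarrow> y"
      unfolding T_power_sum T_power_scale .
    moreover have "eventually (\<lambda>k. (T ^^ n k) ?x \<in> closure (range (\<lambda>n. (T ^^ n) ?x))) sequentially"
      by (intro always_eventually allI subsetD[OF closure_subset] rangeI)
    ultimately show ?thesis
      using Lim_in_closed_set[OF closed_closure, of "\<lambda>k. (T ^^ n k) ?x" _ sequentially y] by simp
  qed
  then show ?thesis by (auto simp: hypercyclic_def)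
qed

lemma hypercyclic_nonzero: "hypercyclic T x \<Longrightarrow> x \<noteq> 0"
proof
  assume "hypercyclic T x" "x = 0"
  moreover have "(T ^^ n) 0 = 0" for n by (induction n) simp_all
  ultimately have "closure {0 :: 'a} = UNIV" by (simp add: hypercyclic_def)
  then show False using nontrivial by auto
qed

text \<open>
  Distinct generators have distinct indices \<open>\<nu> i\<close>, so distinct exponents give index lists with distinct
  multiplicities, and a polynomial without constant term has a leading monomial to which the steering applies.
\<close>

lemma hypercyclic_polynomial_values:
  assumes D: "closure D = UNIV"
    and steer: "\<And>Ls ys y k. admissible (Ls, ys) \<Longrightarrow> y \<in> D \<Longrightarrow> f \<in> steering_set Ls ys y k"
    and g: "inj_on g {..<k}" "g ` {..<k} \<subseteq> range f" and P: "P \<in> polys_without_constant k" "P \<noteq> 0"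
  shows "hypercyclic T (eval_poly smul P g)"
proof -
  have "\<forall>i. \<exists>j. i < k \<longrightarrow> g i = f j" using g(2) by auto
  then obtain \<nu> where \<nu>: "\<And>i. i < k \<Longrightarrow> g i = f (\<nu> i)" by metis
  have inj: "inj_on \<nu> {..<k}" using g(1) \<nu> by (metis inj_on_def lessThan_iff)
  let ?K = "Poly_Mapping.keys P"
  have keys: "Poly_Mapping.keys \<alpha> \<subseteq> {..<k}" if "\<alpha> \<in> ?K" for \<alpha>
    using P(1) that by (simp add: polys_without_constant_def)
  have conv: "eval_monomial g \<alpha> = nonempty_prod (map f (monomial_indices \<nu> \<alpha>))" if "\<alpha> \<in> ?K" for \<alpha>
    using keys[OF that] \<nu> by (rule eval_monomial_conv)
  define L where "L = monomial_indices \<nu> ` ?K"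
  define c where "c xs = Poly_Mapping.lookup P (inv_into ?K (monomial_indices \<nu>) xs)" for xs
  have injK: "inj_on (monomial_indices \<nu>) ?K"
    using exponent_eqI_count[OF keys keys inj] by (intro inj_onI) simp
  have "inj_on count_list L"
    unfolding L_def using exponent_eqI_count[OF keys keys inj] by (auto simp: inj_on_def)
  moreover have L: "finite L" "L \<noteq> {}" using P(2) by (simp_all add: L_def)
  ultimately obtain ys where ys: "ys \<in> L" "\<And>xs. xs \<in> L - {ys} \<Longrightarrow> dominated ys xs"
    by (meson exists_dominating_list)
  have nonempty: "xs \<noteq> []" if xs: "xs \<in> L" for xs
  proof -
    obtain \<alpha> where \<alpha>: "\<alpha> \<in> ?K" "xs = monomial_indices \<nu> \<alpha>" using xs by (auto simp: L_def)
    then have "\<alpha> \<noteq> 0" using P(1) by (auto simp: polys_without_constant_def in_keys_iff)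
    then obtain i where i: "i \<in> Poly_Mapping.keys \<alpha>" by fastforce
    then have "i < k" using keys[OF \<alpha>(1)] by auto
    then have "count_list xs (\<nu> i) \<noteq> 0"
      using count_monomial_indices[OF keys[OF \<alpha>(1)] inj, of i] i by (simp add: \<alpha>(2) in_keys_iff)
    then show ?thesis by auto
  qed
  have "admissible (L - {ys}, ys)" using ys L nonempty by (simp add: admissible_def)
  moreover have "c ys \<noteq> 0" using ys(1) injK by (auto simp: c_def L_def in_keys_iff)
  ultimately have "hypercyclic T (\<Sum>xs\<in>L. smul (c xs) (nonempty_prod (map f xs)))"
    using steer by (intro hypercyclic_combination[OF D L(1) ys(1)]) auto
  also have "(\<Sum>xs\<in>L. smul (c xs) (nonempty_prod (map f xs))) = eval_poly smul P g"
    unfolding L_def eval_poly_def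
    using injK conv by (subst sum.reindex) (auto simp: c_def intro!: sum.cong)
  finally show ?thesis .
qed

lemma range_subset_generated_subalgebra: "range f \<subseteq> generated_subalgebra smul (range f)"
proof
  fix x assume "x \<in> range f"
  define \<alpha> where "\<alpha> = Poly_Mapping.single (0::nat) (1::nat)"
  define P where "P = Poly_Mapping.single \<alpha> (1::complex)"
  have \<alpha>: "Poly_Mapping.keys \<alpha> = {0}" "\<alpha> \<noteq> 0" by (auto simp: \<alpha>_def simp flip: keys_eq_empty)
  have P: "Poly_Mapping.keys P = {\<alpha>}" "P \<noteq> 0" by (auto simp: P_def simp flip: keys_eq_empty)
  have "P \<in> polys_without_constant 1"
    using \<alpha> P by (auto simp: polys_without_constant_def P_def lookup_single when_def)
  moreover have "eval_poly smul P (\<lambda>_. x) = x"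
    by (simp add: eval_poly_def P eval_monomial_def \<alpha>) (simp add: P_def \<alpha>_def)
  moreover have "inj_on (\<lambda>_::nat. x) {..<1}" by (simp add: inj_on_def)
  ultimately show "x \<in> generated_subalgebra smul (range f)"
    unfolding generated_subalgebra_def using \<open>x \<in> range f\<close> P(2)
    by (intro insertI2 CollectI exI[of _ P] exI[of _ "1::nat"] exI[of _ "\<lambda>_. x"]) auto
qed

text \<open>
  Baire's theorem applied to countably many open dense sets: the steering sets for all finite families of monomials
  with a leading one, all targets in a countable dense set and all tolerances, and the sets of sequences that come
  close to a given point of that dense set. Freeness is a by-product, since hypercyclic vectors are nonzero, and
  the algebra is dense because already the set of generators is.
\<close>

theorem generic_hypercyclic_algebra:
  "generically (\<lambda>f :: nat \<Rightarrow> 'a.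
      free_generators smul (range f) \<and>
      closure (generated_subalgebra smul (range f)) = UNIV \<and>
      (\<forall>x \<in> generated_subalgebra smul (range f) - {0}. hypercyclic T x))"
proof -
  obtain D :: "'a set" where D: "countable D" "closure D = UNIV"
    using separable by (auto simp: separable_space_def)
  define hitting where "hitting y k = {f :: nat \<Rightarrow> 'a. \<exists>i. dist (f i) y < inverse (Suc k)}" for y k
  define \<G> where "\<G> = (\<lambda>(p, y, k). steering_set (fst p) (snd p) y k) ` ({p. admissible p} \<times> D \<times> UNIV) \<union>
      (\<lambda>(y, k). hitting y k) ` (D \<times> UNIV)"
  have "countable (Collect finite \<times> (UNIV :: nat list set) :: (nat list set \<times> nat list) set)"
    by (intro countable_SIGMA countable_Collect_finite) simp
  then have "countable {p. admissible p}"
    by (rule countable_subset[rotated]) (auto simp: admissible_def)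
  then have count: "countable \<G>" using D(1) by (auto simp: \<G>_def)
  show ?thesis
  proof (rule generically_if_countable_open_dense[OF count])
    fix G assume "G \<in> \<G>"
    then consider Ls ys y k where "admissible (Ls, ys)" "G = steering_set Ls ys y k" | y k where "G = hitting y k"
      by (auto simp: \<G>_def)
    then have "open G \<and> closure G = UNIV"
    proof cases
      case 1
      then show ?thesis using open_steering_set dense_steering_set by (auto simp: admissible_def)
    next
      case 2
      have "hitting y k = (\<Union>i. {f. dist (f i) y < inverse (Suc k)})" by (auto simp: hitting_def)
      also have "open \<dots>"
        by (intro open_UN ballI open_Collect_less continuous_on_dist continuous_on_const
            continuous_on_product_coordinates)
      finally show ?thesis using 2 dense_hitting_set by (simp add: hitting_def)
    qed
    then show "open G" "closure G = UNIV" by auto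
  next
    fix f assume f: "f \<in> \<Inter>\<G>"
    have steer: "f \<in> steering_set Ls ys y k" if "admissible (Ls, ys)" "y \<in> D" for Ls ys y k
    proof -
      have "steering_set Ls ys y k \<in> \<G>"
        unfolding \<G>_def using that by (intro UnI1 image_eqI[of _ _ "((Ls, ys), y, k)"]) simp_all
      then show ?thesis using f by (rule InterD[rotated])
    qed
    note hyp = hypercyclic_polynomial_values[OF D(2) steer]
    have hit: "\<exists>i. dist (f i) y < inverse (Suc k)" if "y \<in> D" for y k
    proof -
      have "hitting y k \<in> \<G>"
        unfolding \<G>_def using that by (intro UnI2 image_eqI[of _ _ "(y, k)"]) simp_all
      then have "f \<in> hitting y k" using f by (rule InterD[rotated])
      then show ?thesis by (simp add: hitting_def)
    qed
    have "closure (range f) = UNIV"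
      unfolding closure_UNIV_dist
    proof (intro allI impI)
      fix x and e :: real assume "0 < e"
      then obtain k where k: "inverse (Suc k) < e / 2" using reals_Archimedean[of "e / 2"] by auto
      obtain y where y: "y \<in> D" "dist y x < e / 2" using D(2) \<open>0 < e\<close> unfolding closure_UNIV_dist by (meson half_gt_zero)
      obtain i where "dist (f i) y < inverse (Suc k)" using hit y(1) by blast
      then have "dist (f i) x < e" using k y(2) dist_triangle[of "f i" x y] by linarith
      then show "\<exists>y\<in>range f. dist y x < e" by blast
    qed
    then have "closure (generated_subalgebra smul (range f)) = UNIV"
      using closure_mono[OF range_subset_generated_subalgebra[of f]] by auto
    moreover have "free_generators smul (range f)"
      unfolding free_generators_def using hyp hypercyclic_nonzero by blast
    moreover have "hypercyclic T x" if "x \<in> generated_subalgebra smul (range f) - {0}" for x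
      using that hyp by (auto simp: generated_subalgebra_def)
    ultimately show "free_generators smul (range f) \<and>
      closure (generated_subalgebra smul (range f)) = UNIV \<and>
      (\<forall>x \<in> generated_subalgebra smul (range f) - {0}. hypercyclic T x)" by blast
  qed
qed

end

theorem theorem4p4:
  fixes smul :: "complex \<Rightarrow> 'a \<Rightarrow>
      'a::{comm_ring, topological_ab_group_add, topological_semigroup_mult, complete_space}"
    and T :: "'a \<Rightarrow> 'a"
    and E :: "complex \<Rightarrow> 'a"
    and \<phi> :: "complex \<Rightarrow> complex"
    and \<theta> r R :: real
  assumes F_algebra: "comm_F_algebra smul"
    and separable: "separable_space (euclidean :: 'a topology)"
    and nontrivial: "\<exists>x::'a. x \<noteq> 0"
    and dense_free: "\<exists>G. free_generators smul G \<and> closure (generated_subalgebra smul G) = UNIV"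
    and linear_T: "Vector_Spaces.linear smul smul T"
    and continuous_T: "continuous_on UNIV T"
    and entire: "\<phi> holomorphic_on UNIV"
    and phi_0: "cmod (\<phi> 0) = 1"
    and a: "\<And>z. T (E z) = smul (\<phi> z) (E z)"
    and b: "\<And>z w. E z * E w = E (z + w)"
    and c: "\<And>\<Lambda>. (\<exists>z. z islimpt \<Lambda>) \<Longrightarrow> closure (module.span smul (E ` \<Lambda>)) = UNIV"
    and d_odd: "odd (LEAST n. 1 \<le> n \<and> (deriv ^^ n) \<phi> 0 \<noteq> 0)"
    and theta: "0 \<le> \<theta>" "\<theta> < 2 * pi"
    and rR: "0 < r" "0 < R"
    and d_small: "\<And>t. 0 < t \<Longrightarrow> t < r \<Longrightarrow> cmod (\<phi> (of_real t * cis \<theta>)) < 1"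
    and d_large: "ereal (cmod (\<phi> (of_real R * cis \<theta>))) >
        max 1 (exp_ereal (indicator_function \<phi> \<theta> * ereal R))"
  shows "generically (\<lambda>f :: nat \<Rightarrow> 'a.
      free_generators smul (range f) \<and>
      closure (generated_subalgebra smul (range f)) = UNIV \<and>
      (\<forall>x \<in> generated_subalgebra smul (range f) - {0}. hypercyclic T x))"
proof -
  have modulus_at_R_gt_1: "1 < cmod (\<phi> (of_real R * cis \<theta>))"
    using d_large by (simp add: one_ereal_def)
  have total: "closure (module.span smul (E ` \<Lambda>)) = UNIV" if "z islimpt \<Lambda>" for z \<Lambda>
    using c that by blast
  interpret hypercyclic_algebra_setting smul T E \<phi> \<theta> r R
    by (intro hypercyclic_algebra_setting.intro hypercyclic_algebra_setting_axioms.intro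
        exponential_eigenvectors.intro exponential_eigenvectors_axioms.intro)
      (fact F_algebra linear_T continuous_T a b separable nontrivial entire phi_0 total rR d_small modulus_at_R_gt_1)+
  show ?thesis by (rule generic_hypercyclic_algebra)
qed

end
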